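(* Let $b\ge a\ge 1$ be integers, and let $H$ be a connected Hall-type bipartite graph with bipartition sizes $a$ and $b$. Then, as $n\to\infty$, $$Rt_3(H;K_n)=\begin{cases}\displaystyle\left(\frac{1}{3a+b}+o(1)\right)n, & b\le 3a,\\[2ex] \displaystyle\left(\frac{2}{3(a+b)}+o(1)\right)n, & b\ge 3a.\end{cases}$$
   Context: A connected bipartite graph $H$ with bipartition $A\cup B$, $|A|=a\le b=|B|$, is Hall-type if it contains a matching saturating $A$ (i.e. a matching of size $a$). For an edge-colouring $\chi:E(K_n)\to[r]$, let $\nu_H(\chi)$ be the maximum over colours $\ell\in[r]$ of the maximum number of vertex-disjoint copies of $H$ all of whose edges have colour $\ell$. Then $Rt_r(H;K_n):=\min_{\chi:E(K_n)\to[r]}\nu_H(\chi)$. *)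

theory Defs
  imports
    "Graph_Theory.Graph_Theory"
    "HOL-Library.FuncSet"
    "HOL-Library.Disjoint_Sets"
    "HOL-Library.Landau_Symbols"
begin

text \<open>
  A finite simple graph is a \<^locale>\<open>pair_graph\<close>: a finite, loop-free, symmetric set of pairs. Each
  undirected edge is therefore present as two arcs; \<open>edges\<close> identifies them, so that
  colourings and matchings live on undirected edges.
\<close>

definition edges :: "'a pair_pre_digraph \<Rightarrow> 'a set set" where
  "edges G = {{u, v} | u v. (u, v) \<in> parcs G}"

definition bipartition :: "'a pair_pre_digraph \<Rightarrow> 'a set \<Rightarrow> 'a set \<Rightarrow> bool" where
  "bipartition G A B \<longleftrightarrow> A \<union> B = pverts G \<and> A \<inter> B = {} \<and>
     (\<forall>(u, v) \<in> parcs G. (u \<in> A \<and> v \<in> B) \<or> (u \<in> B \<and> v \<in> A))"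

definition matching :: "'a pair_pre_digraph \<Rightarrow> 'a set set \<Rightarrow> bool" where
  "matching G M \<longleftrightarrow> M \<subseteq> edges G \<and> disjoint M"

definition Hall_type :: "'a pair_pre_digraph \<Rightarrow> 'a set \<Rightarrow> 'a set \<Rightarrow> bool" where
  "Hall_type H A B \<longleftrightarrow>
     pair_graph H \<and> Digraph_Component.connected (with_proj H) \<and> bipartition H A B \<and>
     card A \<le> card B \<and> (\<exists>M. matching H M \<and> A \<subseteq> \<Union>M)"

definition complete_graph :: "nat \<Rightarrow> nat pair_pre_digraph" where
  "complete_graph n = \<lparr>pverts = {..<n}, parcs = {(u, v). u < n \<and> v < n \<and> u \<noteq> v}\<rparr>"

definition edge_colourings :: "nat \<Rightarrow> nat \<Rightarrow> (nat set \<Rightarrow> nat) set" where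
  "edge_colourings r n = (edges (complete_graph n) \<rightarrow>\<^sub>E {1..r})"

text \<open>Copies are subgraphs isomorphic to \<open>H\<close>; they need not be induced.\<close>

definition copies :: "'a pair_pre_digraph \<Rightarrow> nat \<Rightarrow> nat pair_pre_digraph set" where
  "copies H n = {C. subgraph (with_proj C) (with_proj (complete_graph n)) \<and>
                    digraph_iso (with_proj H) (with_proj C)}"

definition mono_packing ::
  "'a pair_pre_digraph \<Rightarrow> nat \<Rightarrow> (nat set \<Rightarrow> nat) \<Rightarrow> nat \<Rightarrow> nat pair_pre_digraph set \<Rightarrow> bool" where
  "mono_packing H n \<chi> l P \<longleftrightarrow> P \<subseteq> copies H n \<and>
     (\<forall>C\<in>P. \<forall>e\<in>edges C. \<chi> e = l) \<and>
     pairwise (\<lambda>C D. disjnt (pverts C) (pverts D)) P"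

definition packing_number ::
  "nat \<Rightarrow> 'a pair_pre_digraph \<Rightarrow> nat \<Rightarrow> (nat set \<Rightarrow> nat) \<Rightarrow> nat" where
  "packing_number r H n \<chi> = Max ((\<lambda>l. Max (card ` {P. mono_packing H n \<chi> l P})) ` {1..r})"

definition Rt :: "nat \<Rightarrow> 'a pair_pre_digraph \<Rightarrow> nat \<Rightarrow> nat" where
  "Rt r H n = Min (packing_number r H n ` edge_colourings r n)"

end

theory Submission
  imports Defs
begin

text \<open>
The two upper bounds come from explicit colourings. If the edges of one colour all lie inside a
set \<open>S\<close>, disjoint copies in that colour number at most \<open>|S| / (a + b)\<close>; if they all meet a set \<open>X\<close>,
every copy spends at least \<open>a\<close> vertices of \<open>X\<close>, one for each edge of the matching that saturates
\<open>A\<close>, so there are at most \<open>|X| / a\<close> copies. With \<open>k = n / (3a + b)\<close>, let two colours consist of the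
edges that meet one of two disjoint sets of \<open>a k\<close> vertices, and let the third fill the remaining
\<open>(a + b) k\<close> vertices: every colour is limited to \<open>k\<close> copies. Alternatively cut the vertices into
thirds and let each colour live on two of them, which limits it to \<open>2n / (3(a + b))\<close> copies. The
first bound is at most the second exactly when \<open>b \<le> 3a\<close>.

The lower bound replaces the regularity lemma by a form of linear programming duality in a single
colour. A tile is a monochromatic blow-up of \<open>H\<close> with blocks of a large constant size. Suppose that
for every vertex weighting some tile is cheap compared with the total weight. Then a sequence of
tiles which minimises the squared excess of the vertex loads has small excess altogether, because
the excess is itself a weighting to which the hypothesis applies (\<open>balanced_tiles\<close>). Assigning each
vertex to one block that contains it, so as to minimise the squared deficits of the blocks, then
turns the overlapping tiles into almost the right number of disjoint copies of \<open>H\<close>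
(\<open>balanced_assignment\<close>). Suppose on the other hand that in a colour \<open>l\<close> some weighting makes every
tile expensive. Cutting it at a well chosen threshold gives disjoint sets \<open>I\<^sub>l\<close> (light vertices) and
\<open>N\<^sub>l\<close> (heavy vertices) such that colour \<open>l\<close> has no large biclique with one side in \<open>I\<^sub>l\<close> and the other
outside \<open>N\<^sub>l\<close>, while \<open>n - |I\<^sub>l| + (b/a) |N\<^sub>l|\<close> is smaller than \<open>(a + b) c n\<close>, where \<open>c\<close> is the claimed
density (\<open>threshold_rounding\<close>, \<open>packing_or_sparse_pair\<close>).

This cannot happen in all three colours. For \<open>{i, j, k} = {1, 2, 3}\<close> the sets
\<open>(I\<^sub>i \<inter> I\<^sub>j) - N\<^sub>k\<close> and \<open>I\<^sub>k - (N\<^sub>i \<union> N\<^sub>j)\<close> span no large biclique in any colour, so one of them is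
bounded by bipartite Ramsey. The second one has linear size, hence
\<open>|I\<^sub>i \<inter> I\<^sub>j| \<le> |N\<^sub>k| + O(1)\<close>, and inclusion and exclusion for the three sets \<open>I\<^sub>l\<close> contradicts their size
(\<open>three_colours_leave_no_sparse_pairs\<close>). The two inequalities \<open>c (3a + b) \<le> 1\<close> and
\<open>3c (a + b) \<le> 2\<close> are what this last step uses, and the claimed density is the largest \<open>c\<close> that
satisfies both.
\<close>

section \<open>Balanced families of tiles\<close>

lemma sum_of_bool_mem:
  assumes "finite V" "X \<subseteq> V"
  shows "(\<Sum>v\<in>V. of_bool (v \<in> X) * f v) = (\<Sum>v\<in>X. (f v :: nat))"
proof -
  have "(\<Sum>v\<in>V. of_bool (v \<in> X) * f v) = (\<Sum>v\<in>V. if v \<in> X then f v else 0)"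
    by (rule sum.cong) auto
  also have "\<dots> = (\<Sum>v\<in>V \<inter> X. f v)"
    using assms by (simp add: sum.inter_restrict)
  finally show ?thesis using assms by (simp add: Int_absorb1)
qed

text \<open>
Effect on the squared excess over the capacity \<open>D\<close> when one tile is exchanged for another: \<open>p\<close> and
\<open>q\<close> record whether the vertex lies in the removed and in the added tile. The linear terms weigh a
tile by twice the current excess; the error is one unit per vertex of either tile.
\<close>

lemma excess_step:
  fixes x x' p q D :: nat
  assumes "x' + p = x + q" "p \<le> 1" "q \<le> 1"
  shows "(x' - D)\<^sup>2 + 2 * (p * (x - D)) \<le> (x - D)\<^sup>2 + 2 * (q * (x - D)) + p + q"
proof -
  consider "p = q" | "p = 1" "q = 0" | "p = 0" "q = 1" using assms(2,3) by linarith
  then show ?thesis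
  proof cases
    case 1 then show ?thesis using assms(1) by simp
  next
    case 2
    then obtain z where "x = Suc x'" using assms(1) by auto
    show ?thesis
    proof (cases "x' \<ge> D")
      case True
      then obtain e where "x' = D + e" by (auto simp: le_iff_add)
      then show ?thesis using 2 \<open>x = Suc x'\<close>
        by (simp add: power2_eq_square algebra_simps)
    next
      case False
      then show ?thesis using 2 \<open>x = Suc x'\<close> by simp
    qed
  next
    case 3
    then have "x' = Suc x" using assms(1) by simp
    show ?thesis
    proof (cases "x \<ge> D")
      case True
      then obtain e where "x = D + e" by (auto simp: le_iff_add)
      then show ?thesis using 3 \<open>x' = Suc x\<close>
        by (simp add: power2_eq_square algebra_simps)
    next
      case False
      then show ?thesis using 3 \<open>x' = Suc x\<close> by simp
    qed
  qed
qed

definition block_families :: "'x set \<Rightarrow> 'i set \<Rightarrow> nat \<Rightarrow> ('i \<Rightarrow> 'x set) set" where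
  "block_families V I s =
     {T. (\<forall>i\<in>I. T i \<subseteq> V \<and> card (T i) = s) \<and> disjoint_family_on T I}"

text \<open>
For disjoint blocks this is the indicator function of their union. The counting form makes loads
linear in the tiles.
\<close>

definition multiplicity_in :: "'i set \<Rightarrow> ('i \<Rightarrow> 'x set) \<Rightarrow> 'x \<Rightarrow> nat" where
  "multiplicity_in I T v = (\<Sum>i\<in>I. of_bool (v \<in> T i))"

lemma multiplicity_in_le_1:
  assumes "finite I" "disjoint_family_on T I"
  shows "multiplicity_in I T v \<le> 1"
proof -
  have "multiplicity_in I T v = card {i\<in>I. v \<in> T i}"
    using assms(1) by (simp add: multiplicity_in_def Int_def)
  also have "\<dots> \<le> 1"
    using assms by (subst One_nat_def, subst card_le_Suc0_iff_eq)
      (auto simp: disjoint_family_on_def)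
  finally show ?thesis .
qed

lemma sum_multiplicity_in:
  assumes "finite V" "\<And>i. i \<in> I \<Longrightarrow> T i \<subseteq> V"
  shows "(\<Sum>v\<in>V. multiplicity_in I T v * f v) = (\<Sum>i\<in>I. \<Sum>v\<in>T i. f v)"
proof -
  have "(\<Sum>v\<in>V. multiplicity_in I T v * f v) = (\<Sum>i\<in>I. \<Sum>v\<in>V. of_bool (v \<in> T i) * f v)"
    unfolding multiplicity_in_def sum_distrib_right by (rule sum.swap)
  also have "\<dots> = (\<Sum>i\<in>I. \<Sum>v\<in>T i. f v)"
    using assms by (intro sum.cong refl sum_of_bool_mem)
  finally show ?thesis .
qed

text \<open>
Take the sequence of tiles that minimises the sum of the squared excesses \<open>y\<close> over the capacity
\<open>D\<close>. No exchange of one tile for another helps, so every chosen tile has, up to its size, at most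
the \<open>y\<close>-weight of any other tile, in particular of a tile that is cheap for \<open>y\<close>. Adding this up over
the \<open>M\<close> chosen tiles bounds \<open>\<Sum>v. load v * y v\<close>, and as \<open>load v = D + y v\<close> wherever \<open>y v\<close> is
positive, the terms \<open>D * y v\<close> cancel and the squares remain.
\<close>

lemma balanced_tiles:
  fixes V :: "'x set" and I :: "'i set" and tiles :: "('i \<Rightarrow> 'x set) set"
  assumes V: "finite V" and I: "finite I"
    and tiles: "tiles \<subseteq> block_families V I s"
    and cheap: "\<forall>y :: 'x \<Rightarrow> nat. \<exists>T\<in>tiles. M * (\<Sum>i\<in>I. \<Sum>v\<in>T i. y v) \<le> D * (\<Sum>v\<in>V. y v)"
  obtains \<tau> :: "nat \<Rightarrow> 'i \<Rightarrow> 'x set" where "\<And>j. \<tau> j \<in> tiles"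
    and "(\<Sum>v\<in>V. ((\<Sum>j<M. multiplicity_in I (\<tau> j) v) - D)\<^sup>2) \<le> M * card I * s"
proof -
  have sub: "T i \<subseteq> V" and size: "card (T i) = s" if "T \<in> tiles" "i \<in> I" for T i
    using tiles that by (auto simp: block_families_def)
  have disj: "disjoint_family_on T I" if "T \<in> tiles" for T
    using tiles that by (auto simp: block_families_def)
  define load where "load \<tau> v = (\<Sum>j<M. multiplicity_in I (\<tau> j) v)" for \<tau> :: "nat \<Rightarrow> 'i \<Rightarrow> 'x set" and v
  define cost where "cost \<tau> = (\<Sum>v\<in>V. (load \<tau> v - D)\<^sup>2)" for \<tau>
  obtain T0 where "T0 \<in> tiles" using cheap[rule_format, of "\<lambda>_. 0"] by blast
  then obtain \<tau> where \<tau>: "\<And>j. \<tau> j \<in> tiles" and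
    opt: "\<And>\<tau>'. (\<forall>j. \<tau>' j \<in> tiles) \<Longrightarrow> cost \<tau> \<le> cost \<tau>'"
    using ex_has_least_nat[of "\<lambda>\<tau>. \<forall>j. \<tau> j \<in> tiles" "\<lambda>_. T0" cost] by auto
  define y where "y v = load \<tau> v - D" for v
  define wt where "wt T = (\<Sum>i\<in>I. \<Sum>v\<in>T i. y v)" for T
  have tot: "(\<Sum>v\<in>V. multiplicity_in I T v) = card I * s" if T: "T \<in> tiles" for T
  proof -
    have "(\<Sum>v\<in>V. multiplicity_in I T v * 1) = (\<Sum>i\<in>I. \<Sum>v\<in>T i. 1)"
      using sub[OF T] by (rule sum_multiplicity_in[OF V])
    then show ?thesis using size[OF T] by simp
  qed
  have wt_eq: "wt T = (\<Sum>v\<in>V. multiplicity_in I T v * y v)" if "T \<in> tiles" for T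
    unfolding wt_def using sub[OF that] by (rule sum_multiplicity_in[OF V, symmetric])
  \<comment> \<open>local optimality, compared tile by tile\<close>
  have exch: "wt (\<tau> j) \<le> wt T + card I * s" if j: "j < M" and T: "T \<in> tiles" for j T
  proof -
    define \<tau>' where "\<tau>' = \<tau>(j := T)"
    have l: "load \<tau>' v + multiplicity_in I (\<tau> j) v = load \<tau> v + multiplicity_in I T v" for v
    proof -
      have "load \<sigma> v = (\<Sum>i\<in>{..<M}-{j}. multiplicity_in I (\<sigma> i) v) + multiplicity_in I (\<sigma> j) v" for \<sigma>
        using j by (simp add: load_def sum.remove[of "{..<M}" j])
      moreover have "(\<Sum>i\<in>{..<M}-{j}. multiplicity_in I (\<tau>' i) v) = (\<Sum>i\<in>{..<M}-{j}. multiplicity_in I (\<tau> i) v)"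
        by (rule sum.cong) (auto simp: \<tau>'_def)
      ultimately show ?thesis by (simp add: \<tau>'_def)
    qed
    have "(\<Sum>v\<in>V. (load \<tau>' v - D)\<^sup>2 + 2 * (multiplicity_in I (\<tau> j) v * y v))
      \<le> (\<Sum>v\<in>V. (load \<tau> v - D)\<^sup>2 + 2 * (multiplicity_in I T v * y v)
          + multiplicity_in I (\<tau> j) v + multiplicity_in I T v)"
      unfolding y_def
      by (intro sum_mono excess_step l multiplicity_in_le_1 I disj \<tau> T)
    then have "cost \<tau>' + 2 * wt (\<tau> j) \<le> cost \<tau> + 2 * wt T + card I * s + card I * s"
      unfolding wt_eq[OF \<tau>] wt_eq[OF T] cost_def
      by (simp add: sum.distrib sum_distrib_left tot[OF \<tau>] tot[OF T])
    moreover have "cost \<tau> \<le> cost \<tau>'" using opt[of \<tau>'] \<tau> T by (auto simp: \<tau>'_def)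
    ultimately show ?thesis by linarith
  qed
  obtain T where T: "T \<in> tiles" "M * wt T \<le> D * (\<Sum>v\<in>V. y v)"
    using cheap[rule_format, of y] unfolding wt_def by blast
  have "(\<Sum>v\<in>V. load \<tau> v * y v) = (\<Sum>j<M. \<Sum>v\<in>V. multiplicity_in I (\<tau> j) v * y v)"
    unfolding load_def sum_distrib_right by (rule sum.swap)
  also have "\<dots> = (\<Sum>j<M. wt (\<tau> j))" using wt_eq[OF \<tau>] by simp
  also have "\<dots> \<le> (\<Sum>j<M. wt T + card I * s)" by (rule sum_mono) (use exch T in auto)
  also have "\<dots> = M * wt T + M * card I * s" by (simp add: algebra_simps)
  also have "\<dots> \<le> D * (\<Sum>v\<in>V. y v) + M * card I * s" using T by simp
  finally have 1: "(\<Sum>v\<in>V. load \<tau> v * y v) \<le> D * (\<Sum>v\<in>V. y v) + M * card I * s" .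
  have "load \<tau> v * y v = D * y v + (y v)\<^sup>2" for v
  proof (cases "y v = 0")
    case False
    then have "load \<tau> v = D + y v" unfolding y_def by simp
    then show ?thesis by (simp add: algebra_simps power2_eq_square)
  qed simp
  then have "(\<Sum>v\<in>V. (y v)\<^sup>2) \<le> M * card I * s"
    using 1 by (simp add: sum.distrib sum_distrib_left)
  then show thesis using that[of \<tau>] \<tau> by (simp add: y_def load_def)
qed

lemma squares_move_closer:
  assumes "p \<le> t"
  shows "(p + 1)\<^sup>2 + (t + 1)\<^sup>2 < p\<^sup>2 + (t + 2 :: nat)\<^sup>2"
  using assms by (simp add: power2_eq_square)

section \<open>Assigning vertices to blocks\<close>

lemma sum_two_points:
  assumes "finite Q" "p \<in> Q" "q \<in> Q" "p \<noteq> q"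
  shows "sum f Q = sum f (Q - {p, q}) + f p + (f q :: nat)"
proof -
  have "sum f Q = f p + (f q + sum f (Q - {p} - {q}))"
    using assms by (simp add: sum.remove[of Q p] sum.remove[of "Q - {p}" q])
  moreover have "Q - {p} - {q} = Q - {p,q}" by auto
  ultimately show ?thesis by simp
qed

text \<open>
Each block wants \<open>K\<close> of its \<open>K * D\<close> vertices, and a vertex lies in about \<open>D\<close> blocks. In an assignment
that minimises the squared deficits, no vertex can be moved to a block whose deficit exceeds that of
its own block by more than one (an unassigned vertex counts as having deficit \<open>0\<close>). Summing this
over all incidences compares \<open>K * D\<close> times the deficits with \<open>D\<close> times the deficits weighted by the
current loads, and the difference is \<open>D\<close> times the sum of the squared deficits. Vertices in more
than \<open>D\<close> blocks cost at most \<open>K + 1\<close> for each superfluous block.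
\<close>

lemma balanced_assignment:
  fixes V :: "'x set" and Q :: "'q set" and B :: "'q \<Rightarrow> 'x set"
  assumes V: "finite V" and Q: "finite Q"
    and sub: "\<And>q. q \<in> Q \<Longrightarrow> B q \<subseteq> V"
    and size: "\<And>q. q \<in> Q \<Longrightarrow> card (B q) = K * D"
  obtains f :: "'x \<Rightarrow> 'q option"
  where "\<And>v q. f v = Some q \<Longrightarrow> q \<in> Q \<and> v \<in> B q"
    and "D * (\<Sum>q\<in>Q. (K - card {v\<in>V. f v = Some q})\<^sup>2)
      \<le> D * card V + (K + 1) * (\<Sum>v\<in>V. card {q\<in>Q. v \<in> B q} - D)"
proof -
  define ok where "ok f \<longleftrightarrow> (\<forall>v q. f v = Some q \<longrightarrow> q \<in> Q \<and> v \<in> B q)" for f :: "'x \<Rightarrow> 'q option"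
  define L where "L f q = card {v\<in>V. f v = Some q}" for f :: "'x \<Rightarrow> 'q option" and q
  define cost where "cost f = (\<Sum>q\<in>Q. (K - L f q)\<^sup>2)" for f
  have "ok (\<lambda>_. None)" by (simp add: ok_def)
  then obtain f where f: "ok f" and opt: "\<And>f'. ok f' \<Longrightarrow> cost f \<le> cost f'"
    using ex_has_least_nat[of ok "\<lambda>_. None" cost] by auto
  define d where "d q = K - L f q" for q
  define e where "e v = (case f v of None \<Rightarrow> 0 | Some p \<Rightarrow> d p)" for v
  have near_opt: "d q \<le> e v + 1" if q: "q \<in> Q" "v \<in> B q" for q v
  proof (rule ccontr)
    assume "\<not> d q \<le> e v + 1"
    then have big: "d q \<ge> e v + 2" by simp
    have v: "v \<in> V" using sub q by auto
    define f' where "f' = f(v := Some q)"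
    have ok': "ok f'" using f q by (auto simp: ok_def f'_def)
    have fv: "f v \<noteq> Some q" using big by (auto simp: e_def)
    have "{u\<in>V. f' u = Some q} = insert v {u\<in>V. f u = Some q}"
      using v by (auto simp: f'_def)
    then have Lq: "L f' q = Suc (L f q)" using V fv by (simp add: L_def)
    have Lother: "L f' r = L f r" if "r \<noteq> q" "f v \<noteq> Some r" for r
    proof -
      have "{u\<in>V. f' u = Some r} = {u\<in>V. f u = Some r}"
        using that by (auto simp: f'_def)
      then show ?thesis by (simp add: L_def)
    qed
    have dq: "K - L f' q = d q - 1" using Lq by (simp add: d_def)
    define t where "t = d q - 2"
    have t: "d q = t + 2" using big by (simp add: t_def)
    have "cost f' < cost f"
    proof (cases "f v")
      case None
      have "cost f' = (\<Sum>r\<in>Q-{q}. (K - L f' r)\<^sup>2) + (d q - 1)\<^sup>2"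
        using q Q dq by (simp add: cost_def sum.remove[of Q q])
      also have "(\<Sum>r\<in>Q-{q}. (K - L f' r)\<^sup>2) = (\<Sum>r\<in>Q-{q}. (K - L f r)\<^sup>2)"
        by (rule sum.cong) (use Lother None in auto)
      also have "\<dots> + (d q - 1)\<^sup>2 < \<dots> + (d q)\<^sup>2" using t by (simp add: power2_eq_square)
      also have "\<dots> = cost f"
        using q Q by (simp add: cost_def d_def sum.remove[of Q q])
      finally show ?thesis .
    next
      case (Some p)
      have p: "p \<in> Q" "p \<noteq> q" using f Some fv by (auto simp: ok_def)
      have "{u\<in>V. f u = Some p} = insert v {u\<in>V. f' u = Some p}"
        using v Some p by (auto simp: f'_def)
      moreover have "v \<notin> {u\<in>V. f' u = Some p}" using p by (simp add: f'_def)
      ultimately have "L f p = Suc (L f' p)" using V by (simp add: L_def)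
      then have dp: "K - L f' p \<le> d p + 1" by (simp add: d_def)
      have dpe: "d p \<le> t" using big t Some by (simp add: e_def)
      have "cost f' = (\<Sum>r\<in>Q-{p,q}. (K - L f' r)\<^sup>2) + (K - L f' p)\<^sup>2 + (d q - 1)\<^sup>2"
        using q p Q dq by (simp add: cost_def sum_two_points[of Q p q])
      also have "(\<Sum>r\<in>Q-{p,q}. (K - L f' r)\<^sup>2) = (\<Sum>r\<in>Q-{p,q}. (K - L f r)\<^sup>2)"
        by (rule sum.cong) (use Lother Some in auto)
      also have "\<dots> + (K - L f' p)\<^sup>2 + (d q - 1)\<^sup>2 \<le> \<dots> + (d p + 1)\<^sup>2 + (d q - 1)\<^sup>2"
        using dp by (simp add: power_mono)
      also have "\<dots> < (\<Sum>r\<in>Q-{p,q}. (K - L f r)\<^sup>2) + (d p)\<^sup>2 + (d q)\<^sup>2"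
        using squares_move_closer[OF dpe] t by simp
      also have "\<dots> = cost f"
        using q p Q by (simp add: cost_def d_def sum_two_points[of Q p q])
      finally show ?thesis .
    qed
    with opt[OF ok'] show False by simp
  qed
  define x where "x v = card {q\<in>Q. v \<in> B q}" for v
  have e_le: "e v \<le> K" for v by (auto simp: e_def d_def split: option.split)
  have sume: "(\<Sum>v\<in>V. e v) = (\<Sum>q\<in>Q. L f q * d q)"
  proof -
    have "e v = (\<Sum>q\<in>Q. of_bool (f v = Some q) * d q)" for v
    proof (cases "f v")
      case None then show ?thesis by (simp add: e_def)
    next
      case (Some p)
      then have "p \<in> Q" using f by (auto simp: ok_def)
      have "(\<Sum>q\<in>Q. of_bool (f v = Some q) * d q) = (\<Sum>q\<in>Q. if q = p then d q else 0)"
        using Some by (intro sum.cong) auto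
      then show ?thesis using Q \<open>p \<in> Q\<close> Some by (simp add: e_def)
    qed
    then have "(\<Sum>v\<in>V. e v) = (\<Sum>q\<in>Q. \<Sum>v\<in>V. of_bool (f v = Some q) * d q)"
      by (simp add: sum.swap[of _ V Q])
    also have "\<dots> = (\<Sum>q\<in>Q. L f q * d q)"
      unfolding sum_distrib_right[symmetric] L_def using V by (simp add: Int_def)
    finally show ?thesis .
  qed
  have "(\<Sum>q\<in>Q. K * D * d q) = (\<Sum>q\<in>Q. \<Sum>v\<in>B q. d q)" using size by simp
  also have "\<dots> = (\<Sum>q\<in>Q. \<Sum>v\<in>V. of_bool (v \<in> B q) * d q)"
    using sum_of_bool_mem[OF V sub] by simp
  also have "\<dots> = (\<Sum>v\<in>V. \<Sum>q\<in>Q. of_bool (v \<in> B q) * d q)" by (rule sum.swap)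
  also have "\<dots> \<le> (\<Sum>v\<in>V. \<Sum>q\<in>Q. of_bool (v \<in> B q) * (e v + 1))"
    using near_opt by (intro sum_mono) auto
  also have "\<dots> = (\<Sum>v\<in>V. x v * (e v + 1))"
    unfolding sum_distrib_right[symmetric] x_def using Q by (simp add: Int_def)
  also have "\<dots> \<le> (\<Sum>v\<in>V. D * e v + D + (K + 1) * (x v - D))"
  proof (rule sum_mono)
    fix v
    have "x v * (e v + 1) \<le> (D + (x v - D)) * (e v + 1)" by (intro mult_right_mono) auto
    also have "\<dots> = D * e v + D + (e v + 1) * (x v - D)" by (simp add: algebra_simps)
    also have "\<dots> \<le> D * e v + D + (K + 1) * (x v - D)"
      using e_le[of v] by (intro add_left_mono mult_right_mono) auto
    finally show "x v * (e v + 1) \<le> D * e v + D + (K + 1) * (x v - D)" .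
  qed
  also have "\<dots> = D * (\<Sum>q\<in>Q. L f q * d q) + D * card V + (K + 1) * (\<Sum>v\<in>V. x v - D)"
    by (simp add: sum.distrib sum_distrib_left sume[symmetric])
  finally have "(\<Sum>q\<in>Q. K * D * d q) \<le> D * (\<Sum>q\<in>Q. L f q * d q) + D * card V + (K + 1) * (\<Sum>v\<in>V. x v - D)" .
  moreover have "K * D * d q = D * (d q)\<^sup>2 + D * (L f q * d q)" for q
  proof (cases "d q = 0")
    case False
    then have "K = d q + L f q" by (simp add: d_def)
    then have "K * D * d q = (d q + L f q) * D * d q" by simp
    then show ?thesis by (simp add: algebra_simps power2_eq_square)
  qed simp
  ultimately have "D * (\<Sum>q\<in>Q. (d q)\<^sup>2) \<le> D * card V + (K + 1) * (\<Sum>v\<in>V. x v - D)"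
    by (simp add: sum.distrib sum_distrib_left)
  then show thesis using that[of f] f by (simp add: ok_def d_def L_def x_def)
qed

lemma two_mult_le_squares: "2 * (r * y) \<le> y\<^sup>2 + (r::nat)\<^sup>2"
proof -
  have "real (2 * (r * y)) \<le> real (y\<^sup>2 + r\<^sup>2)"
    using sum_squares_bound[of "real y" "real r"] by (simp add: algebra_simps)
  then show ?thesis by (simp only: of_nat_le_iff)
qed

text \<open>
The constants are chosen so that both errors vanish relative to \<open>M * K\<close>. With \<open>D = (K + 1)\<^sup>2\<close> the
total excess load is at most \<open>(K + 1) * card V\<close>, whose contribution to the squared deficits is again
of order \<open>card V\<close>. There are at most \<open>card V / K\<close> blocks, so a sum of squared deficits of order
\<open>card V\<close> amounts to a total deficit of order \<open>card V / k\<close>, where \<open>k\<close> is the square root of \<open>K\<close>. A tile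
yields at least \<open>K\<close> minus the total deficit of its blocks many disjoint transversals.
\<close>

lemma tiles_to_transversals:
  fixes V :: "'x set" and I :: "'i set" and tiles :: "('i \<Rightarrow> 'x set) set" and k M :: nat
  defines "K \<equiv> k\<^sup>2" and "D \<equiv> (k\<^sup>2 + 1)\<^sup>2"
  assumes V: "finite V" and I: "finite I" 
    and tiles: "tiles \<subseteq> block_families V I (K * D)"
    and few: "M * card I * K \<le> card V"
    and cheap: "\<forall>y :: 'x \<Rightarrow> nat. \<exists>T\<in>tiles. M * (\<Sum>i\<in>I. \<Sum>v\<in>T i. y v) \<le> D * (\<Sum>v\<in>V. y v)"
  obtains C :: "(nat \<times> nat) set" and g :: "nat \<times> nat \<Rightarrow> 'i \<Rightarrow> 'x"
  where "finite C" and "2 * k * (M * K) \<le> 2 * k * card C + 3 * card V"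
    and "\<And>c. c \<in> C \<Longrightarrow> \<exists>T\<in>tiles. \<forall>i\<in>I. g c i \<in> T i"
    and "inj_on (\<lambda>(c, i). g c i) (C \<times> I)"
proof -
  have sub: "T i \<subseteq> V" and size: "card (T i) = K * D" if "T \<in> tiles" "i \<in> I" for T i
    using tiles that by (auto simp: block_families_def)
  obtain \<tau> :: "nat \<Rightarrow> 'i \<Rightarrow> 'x set" where \<tau>: "\<And>j. \<tau> j \<in> tiles"
    and ex2: "(\<Sum>v\<in>V. ((\<Sum>j<M. multiplicity_in I (\<tau> j) v) - D)\<^sup>2) \<le> M * card I * (K * D)"
    using balanced_tiles[OF V I tiles cheap] by blast
  define Q where "Q = {..<M} \<times> I"
  define B where "B q = \<tau> (fst q) (snd q)" for q
  have Q: "finite Q" using I by (simp add: Q_def)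
  have subB: "B q \<subseteq> V" if "q \<in> Q" for q
    using that sub[OF \<tau>] unfolding Q_def B_def by force
  have sizeB: "card (B q) = K * D" if "q \<in> Q" for q
    using that size[OF \<tau>] by (auto simp: Q_def B_def)
  have load: "(\<Sum>j<M. multiplicity_in I (\<tau> j) v) = card {q\<in>Q. v \<in> B q}" for v
  proof -
    have "(\<Sum>j<M. multiplicity_in I (\<tau> j) v) = (\<Sum>q\<in>Q. of_bool (v \<in> B q))"
      unfolding multiplicity_in_def Q_def B_def by (simp add: sum.cartesian_product case_prod_beta)
    then show ?thesis using Q by (simp add: Int_def)
  qed
  define y where "y v = card {q\<in>Q. v \<in> B q} - D" for v
  have D: "D = (K + 1)\<^sup>2" by (simp add: D_def K_def)
  have "(\<Sum>v\<in>V. (y v)\<^sup>2) \<le> M * card I * (K * D)" using ex2 by (simp add: load y_def)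
  also have "\<dots> \<le> card V * D" using mult_right_mono[OF few, of D] by (simp add: mult.assoc)
  finally have y2: "(\<Sum>v\<in>V. (y v)\<^sup>2) \<le> card V * D" .
  have "2 * ((K + 1) * (\<Sum>v\<in>V. y v)) \<le> (\<Sum>v\<in>V. (y v)\<^sup>2 + (K + 1)\<^sup>2)"
    unfolding sum_distrib_left by (intro sum_mono two_mult_le_squares)
  also have "\<dots> \<le> 2 * (card V * D)" using y2 by (simp add: sum.distrib D)
  finally have y1: "(K + 1) * (\<Sum>v\<in>V. y v) \<le> D * card V" by (simp add: mult.commute)
  obtain f :: "'x \<Rightarrow> (nat \<times> 'i) option"
    where f: "\<And>v q. f v = Some q \<Longrightarrow> q \<in> Q \<and> v \<in> B q"
    and d2: "D * (\<Sum>q\<in>Q. (K - card {v\<in>V. f v = Some q})\<^sup>2)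
      \<le> D * card V + (K + 1) * (\<Sum>v\<in>V. card {q\<in>Q. v \<in> B q} - D)"
    using balanced_assignment[where B = B, OF V Q subB sizeB] by blast
  define S where "S q = {v\<in>V. f v = Some q}" for q
  define d where "d q = K - card (S q)" for q
  have "D * (\<Sum>q\<in>Q. (d q)\<^sup>2) \<le> D * card V + (K + 1) * (\<Sum>v\<in>V. y v)"
    using d2 by (simp only: d_def S_def y_def)
  then have "D * (\<Sum>q\<in>Q. (d q)\<^sup>2) \<le> D * (2 * card V)"
    using y1 by linarith
  moreover have "D > 0" by (simp add: D)
  ultimately have d2': "(\<Sum>q\<in>Q. (d q)\<^sup>2) \<le> 2 * card V" by simp
  have "2 * (k * (\<Sum>q\<in>Q. d q)) \<le> (\<Sum>q\<in>Q. (d q)\<^sup>2 + k\<^sup>2)"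
    unfolding sum_distrib_left by (intro sum_mono two_mult_le_squares)
  also have "\<dots> = (\<Sum>q\<in>Q. (d q)\<^sup>2) + M * card I * K"
    by (simp add: sum.distrib Q_def K_def card_cartesian_product)
  also have "\<dots> \<le> 3 * card V" using d2' few by simp
  finally have d1: "2 * (k * (\<Sum>q\<in>Q. d q)) \<le> 3 * card V" .
  define h where "h j = K - (\<Sum>i\<in>I. d (j, i))" for j
  have h_le: "h j \<le> card (S (j, i))" if "i \<in> I" for i j
  proof -
    have "d (j, i) \<le> (\<Sum>i\<in>I. d (j, i))" using I that by (intro member_le_sum[of i I "\<lambda>i. d (j, i)"]) auto
    then show ?thesis by (simp add: h_def d_def)
  qed
  define C where "C = Sigma {..<M} (\<lambda>j. {..<h j})"
  have fin: "finite C" by (simp add: C_def)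
  have "M * K \<le> (\<Sum>j<M. h j + (\<Sum>i\<in>I. d (j, i)))"
    using sum_mono[of "{..<M}" "\<lambda>_. K" "\<lambda>j. h j + (\<Sum>i\<in>I. d (j, i))"] by (simp add: h_def)
  also have "\<dots> = card C + (\<Sum>q\<in>Q. d q)"
    by (simp add: sum.distrib C_def Q_def sum.cartesian_product)
  finally have "2 * k * (M * K) \<le> 2 * k * (card C + (\<Sum>q\<in>Q. d q))" by (rule mult_left_mono) simp
  then have cnt: "2 * k * (M * K) \<le> 2 * k * card C + 3 * card V"
    using d1 by (simp add: algebra_simps)
  have "\<exists>e. bij_betw e {..<card (S q)} (S q)" for q
  proof -
    have "finite (S q)" using V by (simp add: S_def)
    then show ?thesis using ex_bij_betw_nat_finite[of "S q"] by (simp add: atLeast0LessThan)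
  qed
  then obtain e where e: "\<And>q. bij_betw (e q) {..<card (S q)} (S q)" by metis
  define g where "g c i = e (fst c, i) (snd c)" for c i
  have mem: "g c i \<in> S (fst c, i)" if "c \<in> C" "i \<in> I" for c i
  proof -
    have "snd c < card (S (fst c, i))" using that h_le[of i "fst c"] by (auto simp: C_def)
    then show ?thesis using bij_betwE[OF e, of "(fst c, i)"] by (auto simp: g_def)
  qed
  have inj: "inj_on (\<lambda>(c, i). g c i) (C \<times> I)"
  proof (rule inj_onI, clarsimp)
    fix j m i j' m' i'
    assume a: "(j, m) \<in> C" "i \<in> I" "(j', m') \<in> C" "i' \<in> I" "g (j, m) i = g (j', m') i'"
    have "f (g (j, m) i) = Some (j, i)" "f (g (j', m') i') = Some (j', i')"
      using mem[OF a(1,2)] mem[OF a(3,4)] by (auto simp: S_def)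
    with a(5) have eq: "j = j'" "i = i'" by auto
    have "m < card (S (j, i))" "m' < card (S (j, i))"
      using a h_le[of i j] eq by (auto simp: C_def)
    moreover have "e (j, i) m = e (j, i) m'" using a(5) eq by (simp add: g_def)
    ultimately have "m = m'" using e[of "(j, i)"] by (auto simp: bij_betw_def inj_on_def)
    with eq show "j = j' \<and> m = m' \<and> i = i'" by simp
  qed
  have tile: "\<exists>T\<in>tiles. \<forall>i\<in>I. g c i \<in> T i" if "c \<in> C" for c
  proof (intro bexI[of _ "\<tau> (fst c)"] ballI)
    fix i assume "i \<in> I"
    from mem[OF that this] show "g c i \<in> \<tau> (fst c) i" using f by (fastforce simp: S_def B_def)
  qed (rule \<tau>)
  show thesis by (rule that[OF fin cnt tile inj])
qed

text \<open>
The second alternative is the negation of the hypothesis of \<open>tiles_to_transversals\<close>, scaled so that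
every tile has weight at least its block size: an approximate dual solution of the fractional tiling
problem. Division by a total weight of zero gives the zero weighting, which is correct because there
are then no tiles.
\<close>

lemma transversals_or_weights:
  fixes V :: "'x set" and I :: "'i set" and tiles :: "('i \<Rightarrow> 'x set) set" and k M :: nat
  defines "K \<equiv> k\<^sup>2" and "D \<equiv> (k\<^sup>2 + 1)\<^sup>2"
  assumes V: "finite V" and I: "finite I"
    and tiles: "tiles \<subseteq> block_families V I (K * D)"
    and few: "M * card I * K \<le> card V"
  obtains (transversals) C :: "(nat \<times> nat) set" and g :: "nat \<times> nat \<Rightarrow> 'i \<Rightarrow> 'x"
  where "finite C" and "2 * k * (M * K) \<le> 2 * k * card C + 3 * card V"
    and "\<And>c. c \<in> C \<Longrightarrow> \<exists>T\<in>tiles. \<forall>i\<in>I. g c i \<in> T i"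
    and "inj_on (\<lambda>(c, i). g c i) (C \<times> I)"
  | (weights) w :: "'x \<Rightarrow> real"
  where "\<And>v. w v \<ge> 0" and "(\<Sum>v\<in>V. w v) \<le> real (M * K)"
    and "\<And>T. T \<in> tiles \<Longrightarrow> real (K * D) \<le> (\<Sum>i\<in>I. \<Sum>v\<in>T i. w v)"
proof (cases "\<forall>y :: 'x \<Rightarrow> nat. \<exists>T\<in>tiles. M * (\<Sum>i\<in>I. \<Sum>v\<in>T i. y v) \<le> D * (\<Sum>v\<in>V. y v)")
  case True
  show thesis
    using tiles_to_transversals[OF V I tiles[unfolded K_def D_def] few[unfolded K_def]
        True[unfolded D_def]] transversals
    unfolding K_def by blast
next
  case False
  then obtain y :: "'x \<Rightarrow> nat"
    where y: "\<And>T. T \<in> tiles \<Longrightarrow> D * (\<Sum>v\<in>V. y v) < M * (\<Sum>i\<in>I. \<Sum>v\<in>T i. y v)"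
    by (meson not_le)
  define \<sigma> where "\<sigma> = (\<Sum>v\<in>V. y v)"
  define w where "w v = real (M * K) * real (y v) / real \<sigma>" for v
  have tw: "real (K * D) \<le> (\<Sum>i\<in>I. \<Sum>v\<in>T i. w v)" if T: "T \<in> tiles" for T
  proof -
    have "\<sigma> \<noteq> 0"
    proof
      assume "\<sigma> = 0"
      then have "\<And>v. v \<in> V \<Longrightarrow> y v = 0" using V by (simp add: \<sigma>_def)
      moreover have "T i \<subseteq> V" if "i \<in> I" for i
        using tiles T that by (auto simp: block_families_def)
      ultimately have "(\<Sum>i\<in>I. \<Sum>v\<in>T i. y v) = 0" by (intro sum.neutral ballI) auto
      then show False using y[OF T] by simp
    qed
    have "(\<Sum>i\<in>I. \<Sum>v\<in>T i. w v) = real K * real (M * (\<Sum>i\<in>I. \<Sum>v\<in>T i. y v)) / real \<sigma>"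
      unfolding w_def by (simp add: sum_distrib_left sum_divide_distrib algebra_simps)
    also have "\<dots> \<ge> real K * real (D * \<sigma>) / real \<sigma>"
      using y[OF T] unfolding \<sigma>_def
      by (intro divide_right_mono mult_left_mono) (simp_all only: of_nat_le_iff of_nat_0_le_iff less_imp_le)
    finally show ?thesis using \<open>\<sigma> \<noteq> 0\<close> by simp
  qed
  have "(\<Sum>v\<in>V. w v) = real (M * K) * real \<sigma> / real \<sigma>"
    unfolding w_def \<sigma>_def by (simp add: sum_distrib_left sum_divide_distrib)
  also have "\<dots> \<le> real (M * K)" by simp
  finally have "(\<Sum>v\<in>V. w v) \<le> real (M * K)" .
  then show thesis using weights[of w] tw by (simp add: w_def)
qed

section \<open>Cutting a weighting at a threshold\<close>

lemma card_steps_below: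
  fixes z :: real
  assumes "0 \<le> z" "1 \<le> J"
  shows "real (card {j\<in>{1..J}. real j / real J \<le> z}) \<le> J * z"
proof -
  have "{j\<in>{1..J}. real j / real J \<le> z} \<subseteq> {1..nat \<lfloor>J * z\<rfloor>}"
    using assms by (auto simp: le_nat_floor field_simps)
  from card_mono[OF _ this] have "card {j\<in>{1..J}. real j / real J \<le> z} \<le> nat \<lfloor>J * z\<rfloor>"
    by simp
  also have "real (nat \<lfloor>J * z\<rfloor>) \<le> J * z" using assms by simp
  finally show ?thesis by simp
qed

lemma card_steps_near_top:
  fixes z :: real
  assumes "0 \<le> z" "1 \<le> J"
  shows "real (card {j\<in>{1..J}. 1 - real j / real J \<le> z}) \<le> J * z + 1"
proof -
  let ?S = "{j\<in>{1..J}. 1 - real j / real J \<le> z}"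
  have inj: "inj_on (\<lambda>j. J - j) ?S" by (auto simp: inj_on_def)
  have "(\<lambda>j. J - j) ` ?S \<subseteq> {..nat \<lfloor>J * z\<rfloor>}"
  proof (rule image_subsetI)
    fix j assume j: "j \<in> {j\<in>{1..J}. 1 - real j / real J \<le> z}"
    then have "real (J - j) \<le> J * z" using assms by (simp add: field_simps of_nat_diff)
    then show "J - j \<in> {..nat \<lfloor>J * z\<rfloor>}" by (simp add: le_nat_floor)
  qed
  then have "card ?S \<le> card {..nat \<lfloor>J * z\<rfloor>}" using card_inj_on_le[OF inj] by blast
  then have "real (card ?S) \<le> real (nat \<lfloor>J * z\<rfloor>) + 1" by simp
  also have "real (nat \<lfloor>J * z\<rfloor>) \<le> J * z" using assms by simp
  finally show ?thesis by simp
qed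

text \<open>
In the application \<open>\<beta> = b / a\<close> and the vertices of every tile have average weight at least \<open>1\<close>. Light vertices (below \<open>\<theta>\<close>) cost \<open>0\<close>, heavy ones (from \<open>1 + \<beta> (1 - \<theta>)\<close> on) cost
\<open>1 + \<beta>\<close>, the others cost \<open>1\<close>. For \<open>\<theta>\<close> uniform in \<open>(0, 1]\<close> the expected cost of a vertex is at most
\<open>z v\<close>, so some threshold is at most the average. Thresholds are taken from the multiples of \<open>1 / J\<close>,
and the rounding costs at most \<open>\<beta> / J\<close> per vertex.
\<close>

lemma threshold_rounding:
  fixes V :: "'x set" and z :: "'x \<Rightarrow> real" and \<beta> :: real and J :: nat
  assumes V: "finite V" and z: "\<And>v. 0 \<le> z v" and \<beta>: "0 < \<beta>" and J: "1 \<le> J"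
  obtains \<theta> where "0 < \<theta>" "\<theta> \<le> 1"
    and "real (card V) - card {v\<in>V. z v < \<theta>} + \<beta> * card {v\<in>V. 1 + \<beta> * (1 - \<theta>) \<le> z v}
       \<le> (\<Sum>v\<in>V. z v) + \<beta> * card V / J"
proof -
  define c where "c \<theta> v = 1 - of_bool (z v < \<theta>) + \<beta> * of_bool (1 + \<beta> * (1 - \<theta>) \<le> z v)" for \<theta> v
  define cost where "cost \<theta> = (\<Sum>v\<in>V. c \<theta> v)" for \<theta>
  have cost: "cost \<theta> = real (card V) - card {v\<in>V. z v < \<theta>} + \<beta> * card {v\<in>V. 1 + \<beta> * (1 - \<theta>) \<le> z v}" for \<theta>
    using V by (simp add: cost_def c_def sum.distrib sum_subtractf sum_distrib_left[symmetric] Int_def)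
  have pointwise: "(\<Sum>j\<in>{1..J}. c (real j / real J) v) \<le> J * z v + \<beta>" for v
  proof (cases "z v < 1")
    case True
    have "c (real j / real J) v = of_bool (real j / real J \<le> z v)" if "j \<in> {1..J}" for j
    proof -
      have "0 \<le> \<beta> * (1 - real j / real J)" using that \<beta> J by (intro mult_nonneg_nonneg) auto
      then have "\<not> 1 + \<beta> * (1 - real j / real J) \<le> z v" using True by linarith
      then show ?thesis by (auto simp: c_def)
    qed
    then have "(\<Sum>j\<in>{1..J}. c (real j / real J) v) = card {j\<in>{1..J}. real j / real J \<le> z v}"
      by (simp add: Int_def)
    also have "\<dots> \<le> J * z v" by (rule card_steps_below[OF z J])
    finally show ?thesis using \<beta> by simp
  next
    case False
    have eq: "c (real j / real J) v = 1 + \<beta> * of_bool (1 - real j / real J \<le> (z v - 1) / \<beta>)" if "j \<in> {1..J}" for j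
    proof -
      have "real j / real J \<le> 1" using that by (auto simp: divide_simps)
      then have "\<not> z v < real j / real J" using False by linarith
      moreover have "x \<le> (z v - 1) / \<beta> \<longleftrightarrow> 1 + \<beta> * x \<le> z v" for x
        using \<beta> by (simp add: pos_le_divide_eq mult.commute le_diff_eq add.commute)
      ultimately show ?thesis by (simp add: c_def)
    qed
    have "(\<Sum>j\<in>{1..J}. c (real j / real J) v)
        = J + \<beta> * card {j\<in>{1..J}. 1 - real j / real J \<le> (z v - 1) / \<beta>}"
      by (simp add: eq sum.distrib sum_distrib_left[symmetric] Int_def)
    also have "\<dots> \<le> J + \<beta> * (J * ((z v - 1) / \<beta>) + 1)"
      using False \<beta> J by (intro add_left_mono mult_left_mono card_steps_near_top) auto
    also have "\<dots> = J * z v + \<beta>" using \<beta> by (simp add: field_simps)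
    finally show ?thesis .
  qed
  define avg where "avg = (\<Sum>v\<in>V. z v) + \<beta> * card V / J"
  have "\<exists>j\<in>{1..J}. cost (real j / real J) \<le> avg"
  proof (rule ccontr)
    assume "\<not> ?thesis"
    then have "avg < cost (real j / real J)" if "j \<in> {1..J}" for j
      using that not_le by blast
    then have "(\<Sum>j\<in>{1..J}. avg) < (\<Sum>j\<in>{1..J}. cost (real j / real J))"
      using J by (intro sum_strict_mono) auto
    also have "\<dots> = (\<Sum>v\<in>V. \<Sum>j\<in>{1..J}. c (real j / real J) v)"
      unfolding cost_def by (rule sum.swap)
    also have "\<dots> \<le> (\<Sum>v\<in>V. J * z v + \<beta>)" by (rule sum_mono) (rule pointwise)
    also have "\<dots> = J * avg"
      using J by (simp add: avg_def sum.distrib sum_distrib_left field_simps)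
    finally show False by simp
  qed
  then obtain j where j: "j \<in> {1..J}" "cost (real j / real J) \<le> avg" by blast
  show thesis
  proof (rule that[of "real j / real J"])
    show "0 < real j / real J" "real j / real J \<le> 1" using j(1) by auto
    show "real (card V) - card {v\<in>V. z v < real j / real J}
        + \<beta> * card {v\<in>V. 1 + \<beta> * (1 - real j / real J) \<le> z v} \<le> (\<Sum>v\<in>V. z v) + \<beta> * card V / J"
      using j(2) by (simp add: cost avg_def)
  qed
qed

section \<open>Three colours cannot all be sparse\<close>

lemma pigeonhole_fibre:
  assumes "finite A" "finite B" "f ` A \<subseteq> B" "card B * p \<le> card A" "A \<noteq> {}" "0 < p"
  obtains y where "y \<in> B" "p \<le> card {x\<in>A. f x = y}"
proof (rule ccontr)
  assume "\<not> thesis"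
  with that have small: "card {x\<in>A. f x = y} < p" if "y \<in> B" for y
    using \<open>y \<in> B\<close> not_le by blast
  have "B \<noteq> {}" using assms(3,5) by auto
  have "card A = (\<Sum>y\<in>B. card {x\<in>A. f x = y})"
    using sum.group[OF assms(1-3), of "\<lambda>_. 1 :: nat"] by simp
  also have "\<dots> < (\<Sum>y\<in>B. p)" using small \<open>B \<noteq> {}\<close> assms(2) by (intro sum_strict_mono) auto
  also have "\<dots> \<le> card A" using assms(4) by simp
  finally show False by simp
qed

text \<open>
Majority colours on \<open>r * Suc p\<close> vertices of one side give each vertex of the other side a colour and
a subset of these vertices; the bound pays for the pigeonhole over all such pairs. \<open>Suc p\<close> instead
of \<open>p\<close> keeps all fibres nonempty when \<open>p = 0\<close>.
\<close>

definition biclique_bound :: "nat \<Rightarrow> nat \<Rightarrow> nat" where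
  "biclique_bound r p = Suc (r * Suc p + r * 2 ^ (r * Suc p) * Suc p)"

lemma bipartite_ramsey:
  fixes U :: "'x set" and W :: "'y set" and r p :: nat
  assumes U: "biclique_bound r p \<le> card U" and W: "biclique_bound r p \<le> card W"
    and \<psi>: "\<And>u w. u \<in> U \<Longrightarrow> w \<in> W \<Longrightarrow> \<psi> u w \<in> {1..r}"
  shows "\<exists>X\<subseteq>U. \<exists>Y\<subseteq>W. \<exists>l\<in>{1..r}. card X = p \<and> card Y = p \<and> (\<forall>x\<in>X. \<forall>y\<in>Y. \<psi> x y = l)"
proof -
  define q where "q = Suc p"
  have finU: "finite U" and neU: "U \<noteq> {}" using U by (auto simp: biclique_bound_def intro: card_ge_0_finite)
  have neW: "W \<noteq> {}" using W by (auto simp: biclique_bound_def q_def)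
  from neU neW obtain u w where "u \<in> U" "w \<in> W" by blast
  from \<psi>[OF this] have r: "1 \<le> r" by simp
  have "r * q \<le> card W" using W by (simp add: biclique_bound_def q_def)
  then obtain W' where W': "W' \<subseteq> W" "card W' = r * q" "finite W'"
    by (rule obtain_subset_with_card_n)
  have "\<exists>l\<in>{1..r}. q \<le> card {w\<in>W'. \<psi> u w = l}" if "u \<in> U" for u
  proof (rule pigeonhole_fibre[of W' "{1..r}" "\<psi> u" q])
    show "\<psi> u ` W' \<subseteq> {1..r}" using \<psi>[OF that] W'(1) by blast
    show "W' \<noteq> {}" using W'(2) r by (auto simp: q_def)
  qed (use W' in \<open>auto simp: q_def\<close>)
  then obtain l where l: "\<And>u. u \<in> U \<Longrightarrow> l u \<in> {1..r} \<and> q \<le> card {w\<in>W'. \<psi> u w = l u}" by metis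
  define F where "F u = (l u, {w\<in>W'. \<psi> u w = l u})" for u
  have FU: "F ` U \<subseteq> {1..r} \<times> Pow W'" using l by (auto simp: F_def)
  have "card ({1..r} \<times> Pow W') * q \<le> card U"
    using U W' by (simp add: biclique_bound_def q_def card_cartesian_product card_Pow)
  moreover have "finite ({1..r} \<times> Pow W')" using W'(3) by simp
  ultimately obtain y where y: "y \<in> {1..r} \<times> Pow W'" "q \<le> card {u\<in>U. F u = y}"
    using pigeonhole_fibre[OF finU _ FU _ neU, of q] by (auto simp: q_def)
  obtain c S where cS: "y = (c, S)" "c \<in> {1..r}" "S \<subseteq> W'" using y(1) by auto
  have "p \<le> card {u\<in>U. F u = y}" using y(2) by (simp add: q_def)
  then obtain X where X: "X \<subseteq> {u\<in>U. F u = y}" "card X = p"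
    by (rule obtain_subset_with_card_n)
  have "{u\<in>U. F u = y} \<noteq> {}"
  proof
    assume "{u\<in>U. F u = y} = {}"
    then show False using y(2) by (simp only: q_def card.empty)
  qed
  then obtain u where "u \<in> U" "F u = y" by blast
  then have "p \<le> card S" using l[of u] cS(1) by (auto simp: F_def q_def)
  then obtain Y where Y: "Y \<subseteq> S" "card Y = p" by (rule obtain_subset_with_card_n)
  have "\<psi> x y = c" if "x \<in> X" "y \<in> Y" for x y
    using that X(1) Y(1) cS(1) by (auto simp: F_def)
  then show "\<exists>X\<subseteq>U. \<exists>Y\<subseteq>W. \<exists>l\<in>{1..r}. card X = p \<and> card Y = p \<and> (\<forall>x\<in>X. \<forall>y\<in>Y. \<psi> x y = l)"
    using X Y cS W'(1) by (intro exI[of _ X] exI[of _ Y] conjI bexI[of _ c]) auto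
qed

text \<open>
The disjointness of \<open>X\<close> and \<open>Y\<close> makes the condition meaningful for overlapping \<open>I\<close> and \<open>J\<close>: with
\<open>I \<subseteq> J\<close> it also excludes bicliques inside \<open>I\<close>.
\<close>

definition biclique_free :: "('x \<Rightarrow> 'x \<Rightarrow> nat) \<Rightarrow> nat \<Rightarrow> nat \<Rightarrow> 'x set \<Rightarrow> 'x set \<Rightarrow> bool" where
  "biclique_free \<psi> l p I J \<longleftrightarrow>
     (\<forall>X Y. X \<subseteq> I \<longrightarrow> Y \<subseteq> J \<longrightarrow> X \<inter> Y = {} \<longrightarrow> card X = p \<longrightarrow> card Y = p
       \<longrightarrow> (\<exists>x\<in>X. \<exists>y\<in>Y. \<psi> x y \<noteq> l))"

text \<open>
Let \<open>{i, j, k} = {1, 2, 3}\<close>. A biclique between \<open>U = (I i \<inter> I j) - N k\<close> and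
\<open>W = I k - (N i \<union> N j)\<close> can have no colour: colours \<open>i\<close> and \<open>j\<close> are excluded by its side in \<open>U\<close>, colour
\<open>k\<close> by its side in \<open>W\<close>. The size hypothesis gives \<open>|N i| + |N j| \<le> t |V|\<close> and hence makes \<open>W\<close> large,
so \<open>U\<close> is bounded. Summing \<open>|I i \<inter> I j| \<le> |N k| + C\<close> over the three pairs contradicts \<open>3 t \<ge> 1\<close> and
\<open>\<beta> \<ge> 1\<close>. The sets \<open>U\<close> and \<open>W\<close> meet only in the triple intersection, which is bounded because all
colours are sparse inside it.
\<close>

lemma three_colours_leave_no_sparse_pairs:
  fixes V :: "'x set" and I N :: "nat \<Rightarrow> 'x set" and \<psi> :: "'x \<Rightarrow> 'x \<Rightarrow> nat" and \<beta> t \<delta> :: real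
  assumes V: "finite V" and sym: "\<And>u v. \<psi> u v = \<psi> v u"
    and I: "\<And>l. I l \<subseteq> V" and N: "\<And>l. N l \<subseteq> V" and disj: "\<And>l. I l \<inter> N l = {}"
    and ramsey: "\<And>U W. \<lbrakk>U \<subseteq> V; W \<subseteq> V; U \<inter> W = {}; C \<le> card U; C \<le> card W\<rbrakk>
      \<Longrightarrow> \<exists>X\<subseteq>U. \<exists>Y\<subseteq>W. \<exists>l\<in>{1..3}. card X = p \<and> card Y = p \<and> (\<forall>x\<in>X. \<forall>y\<in>Y. \<psi> x y = l)"
    and free: "\<And>l. l \<in> {1..3} \<Longrightarrow> biclique_free \<psi> l p (I l) (V - N l)"
    and large: "\<And>l. l \<in> {1..3} \<Longrightarrow> \<beta> * card (N l) + t * card V + \<delta> \<le> card (I l)"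
    and \<beta>: "1 \<le> \<beta>" and t: "1 \<le> 3 * t" "2 * (1 - t) \<le> t * (1 + \<beta>)" and \<delta>: "3 * C < \<delta>"
  shows False
proof -
  have sparse: "\<exists>x\<in>X. \<exists>y\<in>Y. \<psi> x y \<noteq> l"
    if "l \<in> {1..3}" "X \<subseteq> I l" "Y \<subseteq> V - N l" "X \<inter> Y = {}" "card X = p" "card Y = p" for l X Y
    using free[OF that(1)] that(2-) unfolding biclique_free_def by blast
  have fin: "finite A" if "A \<subseteq> V" for A using V that finite_subset by blast
  have finI: "finite (I l)" and finN: "finite (N l)" for l using fin I N by blast+
  have key: "card (I i \<inter> I j) \<le> card (N k) + C" if ijk: "{i, j, k} = {1..3}" for i j k
  proof (rule ccontr)
    assume big: "\<not> card (I i \<inter> I j) \<le> card (N k) + C"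
    have rng: "i \<in> {1..3}" "j \<in> {1..3}" "k \<in> {1..3}" using ijk by blast+
    define T where "T = I i \<inter> I j \<inter> I k"
    have T: "card T < 2 * C"
    proof (rule ccontr)
      assume "\<not> card T < 2 * C"
      then obtain T1 where T1: "T1 \<subseteq> T" "card T1 = C"
        using obtain_subset_with_card_n[of C T] by auto
      have TV: "T \<subseteq> V" using I by (auto simp: T_def)
      have "C \<le> card (T - T1)"
        using \<open>\<not> card T < 2 * C\<close> T1 fin[of T1] TV by (simp add: card_Diff_subset)
      then obtain X Y l where l: "X \<subseteq> T1" "Y \<subseteq> T - T1" "l \<in> {1..3}" "card X = p" "card Y = p"
        "\<forall>x\<in>X. \<forall>y\<in>Y. \<psi> x y = l"
        using ramsey[of T1 "T - T1"] T1 TV by blast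
      have "l \<in> {i, j, k}" using l(3) ijk by simp
      then have "T \<subseteq> I l" by (auto simp: T_def)
      then have "X \<subseteq> I l" "Y \<subseteq> V - N l" "X \<inter> Y = {}" using l(1,2) T1(1) TV disj[of l] by blast+
      from sparse[OF l(3) this l(4,5)] l(6) show False by blast
    qed
    define U where "U = I i \<inter> I j - N k"
    define W where "W = I k - (N i \<union> N j)"
    have U: "C \<le> card U"
    proof -
      have "card (I i \<inter> I j) \<le> card U + card (N k)"
        using card_mono[of "U \<union> N k" "I i \<inter> I j"] card_Un_le[of U "N k"] finI finN by (auto simp: U_def)
      then show ?thesis using big by linarith
    qed
    \<comment> \<open>\<open>I l\<close> is at least \<open>\<beta>\<close> times as large as \<open>N l\<close>, and both fit disjointly into \<open>V\<close>\<close>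
    have half: "(1 + \<beta>) * card (N l) \<le> (1 - t) * card V" if "l \<in> {1..3}" for l
    proof -
      have "card (I l) + card (N l) \<le> card V"
        using card_Un_disjoint[OF finI finN disj] card_mono[OF V, of "I l \<union> N l"] I N by simp
      then have "real (card (I l)) + card (N l) \<le> card V" by linarith
      then show ?thesis using large[OF that] \<delta> by (simp add: algebra_simps)
    qed
    have "(1 + \<beta>) * (real (card (N i)) + card (N j)) \<le> (2 * (1 - t)) * card V"
      using half[OF rng(1)] half[OF rng(2)] by (simp add: algebra_simps)
    also have "\<dots> \<le> (t * (1 + \<beta>)) * card V" using t by (intro mult_right_mono) auto
    finally have "(1 + \<beta>) * (real (card (N i)) + card (N j)) \<le> (1 + \<beta>) * (t * card V)"
      by (simp add: algebra_simps)
    then have NN: "real (card (N i)) + card (N j) \<le> t * card V" using \<beta> by simp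
    have "0 \<le> \<beta> * card (N k)" using \<beta> by simp
    then have "t * card V + \<delta> \<le> card (I k)" using large[OF rng(3)] by linarith
    then have Ik: "card (N i) + card (N j) + 3 * C < card (I k)" using NN \<delta> by linarith
    have "I k \<subseteq> (W - U) \<union> (N i \<union> N j) \<union> T" by (auto simp: W_def U_def T_def)
    then have "card (I k) \<le> card ((W - U) \<union> (N i \<union> N j) \<union> T)"
      using finI finN by (intro card_mono) (auto simp: W_def T_def)
    also have "\<dots> \<le> card (W - U) + (card (N i) + card (N j)) + card T"
      using card_Un_le[of "(W - U) \<union> (N i \<union> N j)" T] card_Un_le[of "W - U" "N i \<union> N j"]
        card_Un_le[of "N i" "N j"] by linarith
    finally have W: "C \<le> card (W - U)" using Ik T by linarith
    have "U \<subseteq> V" "W - U \<subseteq> V" "U \<inter> (W - U) = {}" using I by (auto simp: U_def W_def)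
    from ramsey[OF this U W] obtain X Y l where l: "X \<subseteq> U" "Y \<subseteq> W - U" "l \<in> {1..3}" "card X = p" "card Y = p"
        "\<forall>x\<in>X. \<forall>y\<in>Y. \<psi> x y = l" by blast
    have XY: "X \<inter> Y = {}" using l(1,2) by blast
    have "l \<in> {i, j, k}" using l(3) ijk by simp
    then consider "l = i \<or> l = j" | "l = k" by blast
    then show False
    proof cases
      case 1
      then have "X \<subseteq> I l" "Y \<subseteq> V - N l" using l(1,2) I[of k] by (auto simp: U_def W_def)
      from sparse[OF l(3) this XY l(4,5)] l(6) show False by blast
    next
      case 2
      then have "Y \<subseteq> I l" "X \<subseteq> V - N l" using l(1,2) I[of i] by (auto simp: U_def W_def)
      moreover have "Y \<inter> X = {}" using XY by blast
      ultimately obtain y x where "y \<in> Y" "x \<in> X" "\<psi> y x \<noteq> l" using sparse[OF l(3) _ _ _ l(5,4)] by blast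
      then show False using l(6) sym by metis
    qed
  qed
  have set3: "{1..3::nat} = {1, 2, 3}" by auto
  have "card (I 1) + card (I 2) + card (I 3) \<le> card V + card (I 1 \<inter> I 2) + card (I 1 \<inter> I 3) + card (I 2 \<inter> I 3)"
  proof -
    have "card (I 1) + card (I 2) = card (I 1 \<union> I 2) + card (I 1 \<inter> I 2)"
      by (rule card_Un_Int[OF finI finI])
    moreover have "card (I 1 \<union> I 2) + card (I 3) = card (I 1 \<union> I 2 \<union> I 3) + card ((I 1 \<union> I 2) \<inter> I 3)"
      using finI by (intro card_Un_Int) auto
    moreover have "card (I 1 \<union> I 2 \<union> I 3) \<le> card V" using I V by (intro card_mono) auto
    moreover have "card ((I 1 \<union> I 2) \<inter> I 3) \<le> card (I 1 \<inter> I 3) + card (I 2 \<inter> I 3)"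
      unfolding Int_Un_distrib2 by (rule card_Un_le)
    ultimately show ?thesis by linarith
  qed
  also have "\<dots> \<le> card V + (card (N 3) + C) + (card (N 2) + C) + (card (N 1) + C)"
    using key[of 1 2 3] key[of 1 3 2] key[of 2 3 1] unfolding set3 by (intro add_mono) auto
  finally have up: "real (card (I 1)) + card (I 2) + card (I 3)
      \<le> card V + card (N 1) + card (N 2) + card (N 3) + 3 * C" by linarith
  have lo: "card (N l) + t * card V + \<delta> \<le> card (I l)" if "l \<in> {1..3}" for l
  proof -
    have "1 * real (card (N l)) \<le> \<beta> * card (N l)" using \<beta> by (intro mult_right_mono) auto
    then show ?thesis using large[OF that] by simp
  qed
  have "1 * real (card V) \<le> (3 * t) * card V" using t by (intro mult_right_mono) auto
  then show False using up lo[of 1] lo[of 2] lo[of 3] \<delta> by simp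
qed

section \<open>Copies, packings and colourings\<close>

definition image_graph :: "('v \<Rightarrow> 'w) \<Rightarrow> 'v pair_pre_digraph \<Rightarrow> 'w pair_pre_digraph" where
  "image_graph f H = \<lparr>pverts = f ` pverts H, parcs = map_prod f f ` parcs H\<rparr>"

lemma image_graph_simps [simp]:
  "pverts (image_graph f H) = f ` pverts H"
  "parcs (image_graph f H) = map_prod f f ` parcs H"
  by (simp_all add: image_graph_def)

lemma edges_image_graph: "edges (image_graph f H) = (\<lambda>e. f ` e) ` edges H"
proof (intro equalityI subsetI)
  fix e assume "e \<in> edges (image_graph f H)"
  then obtain u v where "(u, v) \<in> parcs H" "e = {f u, f v}" by (auto simp: edges_def)
  then show "e \<in> (\<lambda>e. f ` e) ` edges H" unfolding edges_def by (intro image_eqI[of _ _ "{u, v}"]) auto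
next
  fix e assume "e \<in> (\<lambda>e. f ` e) ` edges H"
  then obtain u v where "(u, v) \<in> parcs H" "e = {f u, f v}" by (auto simp: edges_def)
  then show "e \<in> edges (image_graph f H)" unfolding edges_def by (force simp: image_iff)
qed

lemma complete_graph_simps [simp]:
  "pverts (complete_graph n) = {..<n}"
  "(u, v) \<in> parcs (complete_graph n) \<longleftrightarrow> u < n \<and> v < n \<and> u \<noteq> v"
  by (simp_all add: complete_graph_def)

lemma wf_complete_graph: "wf_digraph (with_proj (complete_graph n))"
  by unfold_locales auto

lemma edges_complete_graph: "edges (complete_graph n) = {{u, v} | u v. u < n \<and> v < n \<and> u \<noteq> v}"
  by (simp add: edges_def)

lemma image_graph_in_copies:
  assumes "pair_graph H" "inj_on f (pverts H)" "f ` pverts H \<subseteq> {..<n}"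
  shows "image_graph f H \<in> copies H n"
proof -
  interpret pair_graph H by fact
  have wf: "wf_digraph (with_proj (image_graph f H))"
    by unfold_locales (auto dest: in_arcsD1 in_arcsD2)
  have "parcs (image_graph f H) \<subseteq> parcs (complete_graph n)"
  proof
    fix e assume "e \<in> parcs (image_graph f H)"
    then obtain u v where uv: "(u, v) \<in> parcs H" "e = (f u, f v)" by auto
    have "u \<noteq> v" using no_loops'[OF uv(1)] .
    then have "f u \<noteq> f v" using assms(2) in_arcsD1[OF uv(1)] in_arcsD2[OF uv(1)] by (auto dest: inj_onD)
    then show "e \<in> parcs (complete_graph n)"
      using uv assms(3) in_arcsD1[OF uv(1)] in_arcsD2[OF uv(1)] by auto
  qed
  then have sub: "subgraph (with_proj (image_graph f H)) (with_proj (complete_graph n))"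
    using wf wf_complete_graph assms(3) by (simp add: subgraph_def compatible_def)
  define h where "h = \<lparr>iso_verts = f, iso_arcs = map_prod f f, iso_head = snd, iso_tail = fst\<rparr>"
  have "inj_on (map_prod f f) (parcs H)"
  proof (rule inj_onI)
    fix x y assume "x \<in> parcs H" "y \<in> parcs H" "map_prod f f x = map_prod f f y"
    then show "x = y"
      using assms(2) by (cases x; cases y) (auto dest: in_arcsD1 in_arcsD2 inj_onD)
  qed
  then have "pre_digraph.digraph_isomorphism (with_proj H) h"
    using assms(2) wf_digraph by (auto simp: pre_digraph.digraph_isomorphism_def h_def)
  moreover have "with_proj (image_graph f H) = app_iso h (with_proj H)"
    by (simp add: app_iso_def h_def with_proj_def)
  ultimately show ?thesis using sub by (auto simp: copies_def digraph_iso_def)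
qed

text \<open>
A digraph isomorphism carries its own map on arcs, but between graphs whose arcs are pairs this map
is determined by the one on vertices.
\<close>

lemma copiesE:
  assumes "C \<in> copies H n"
  obtains f where "inj_on f (pverts H)" "C = image_graph f H" "f ` pverts H \<subseteq> {..<n}"
proof -
  from assms obtain h where h: "pre_digraph.digraph_isomorphism (with_proj H) h"
    and C: "with_proj C = app_iso h (with_proj H)"
    and sub: "subgraph (with_proj C) (with_proj (complete_graph n))"
    by (auto simp: copies_def digraph_iso_def)
  define f where "f = iso_verts h"
  have verts: "pverts C = f ` pverts H" using arg_cong[OF C, of verts] by (simp add: f_def)
  have "parcs C = iso_arcs h ` parcs H" using arg_cong[OF C, of arcs] by simp
  moreover have "iso_arcs h a = map_prod f f a" if "a \<in> parcs H" for a
  proof -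
    have "iso_tail h = fst" "iso_head h = snd"
      using arg_cong[OF C, of tail] arg_cong[OF C, of head] by simp_all
    moreover have "f (fst a) = iso_tail h (iso_arcs h a)" "f (snd a) = iso_head h (iso_arcs h a)"
      using h that by (simp_all add: pre_digraph.digraph_isomorphism_def f_def)
    ultimately show ?thesis by (simp add: prod_eq_iff)
  qed
  ultimately have "parcs C = map_prod f f ` parcs H" by simp
  with verts have "C = image_graph f H" by (simp add: image_graph_def)
  moreover have "inj_on f (pverts H)"
    using h by (simp add: pre_digraph.digraph_isomorphism_def f_def)
  moreover have "f ` pverts H \<subseteq> {..<n}" using sub verts by (auto simp: subgraph_def)
  ultimately show thesis using that by blast
qed

lemma edges_copy_subset: "C \<in> copies H n \<Longrightarrow> edges C \<subseteq> edges (complete_graph n)"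
  unfolding copies_def edges_def subgraph_def by fastforce

lemma finite_copies: "finite (copies H n)"
proof (rule finite_subset)
  let ?F = "\<lambda>(V, E). \<lparr>pverts = V, parcs = E\<rparr>"
  show "copies H n \<subseteq> ?F ` (Pow {..<n} \<times> Pow ({..<n} \<times> {..<n}))"
  proof
    fix C assume C: "C \<in> copies H n"
    then have "parcs C \<subseteq> parcs (complete_graph n)" "pverts C \<subseteq> {..<n}"
      by (auto simp: copies_def subgraph_def)
    moreover have "parcs (complete_graph n) \<subseteq> {..<n} \<times> {..<n}" by auto
    ultimately have "(pverts C, parcs C) \<in> Pow {..<n} \<times> Pow ({..<n} \<times> {..<n})" by blast
    moreover have "C = ?F (pverts C, parcs C)" by simp
    ultimately show "C \<in> ?F ` (Pow {..<n} \<times> Pow ({..<n} \<times> {..<n}))" by blast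
  qed
qed simp

lemma finite_mono_packings: "finite {P. mono_packing H n \<chi> l P}"
  by (rule finite_subset[of _ "Pow (copies H n)"]) (auto simp: mono_packing_def finite_copies)

lemma mono_packing_empty: "mono_packing H n \<chi> l {}"
  by (simp add: mono_packing_def)

lemma card_le_packing_number:
  assumes "mono_packing H n \<chi> l P" "l \<in> {1..r}"
  shows "card P \<le> packing_number r H n \<chi>"
proof -
  have "card P \<le> Max (card ` {P. mono_packing H n \<chi> l P})"
    using assms(1) by (intro Max_ge finite_imageI finite_mono_packings) auto
  also have "\<dots> \<le> packing_number r H n \<chi>"
    unfolding packing_number_def using assms(2) by (intro Max_ge) auto
  finally show ?thesis .
qed

lemma packing_number_le:
  assumes "\<And>l P. l \<in> {1..r} \<Longrightarrow> mono_packing H n \<chi> l P \<Longrightarrow> card P \<le> m" "1 \<le> r"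
  shows "packing_number r H n \<chi> \<le> m"
proof -
  have "Max (card ` {P. mono_packing H n \<chi> l P}) \<le> m" if "l \<in> {1..r}" for l
    using assms(1)[OF that] mono_packing_empty[of H n \<chi> l]
    by (intro Max.boundedI finite_imageI finite_mono_packings) auto
  then show ?thesis
    unfolding packing_number_def using assms(2) by (intro Max.boundedI) auto
qed

lemma finite_edges_complete_graph: "finite (edges (complete_graph n))"
  by (rule finite_subset[of _ "Pow {..<n}"]) (auto simp: edges_complete_graph)

lemma finite_edge_colourings: "finite (edge_colourings r n)"
  unfolding edge_colourings_def by (intro finite_PiE finite_edges_complete_graph) simp

text \<open>
Colourings need only be given as total functions on sets: values outside the edge set of the
complete graph do not influence packings.
\<close>

lemma Rt_le:
  assumes F: "\<And>e. F e \<in> {1..r}"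
    and small: "\<And>l P. l \<in> {1..r} \<Longrightarrow> mono_packing H n F l P \<Longrightarrow> card P \<le> m"
  shows "Rt r H n \<le> m"
proof -
  define \<chi> where "\<chi> = restrict F (edges (complete_graph n))"
  have \<chi>: "\<chi> \<in> edge_colourings r n" using F by (auto simp: \<chi>_def edge_colourings_def)
  have "mono_packing H n \<chi> l P \<longleftrightarrow> mono_packing H n F l P" for l P
    using edges_copy_subset unfolding mono_packing_def \<chi>_def
    by (metis (no_types, lifting) restrict_apply' subsetD)
  moreover have "1 \<le> r" using F[of "{}"] by auto
  ultimately have "packing_number r H n \<chi> \<le> m"
    using small by (intro packing_number_le) auto
  moreover have "Rt r H n \<le> packing_number r H n \<chi>"
    unfolding Rt_def using \<chi> finite_edge_colourings by (intro Min_le) auto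
  ultimately show ?thesis by linarith
qed

lemma Rt_attained:
  assumes "1 \<le> r"
  obtains \<chi> where "\<chi> \<in> edge_colourings r n" "Rt r H n = packing_number r H n \<chi>"
proof -
  have "edge_colourings r n \<noteq> {}" using assms by (simp add: edge_colourings_def PiE_eq_empty_iff)
  then have "Rt r H n \<in> packing_number r H n ` edge_colourings r n"
    unfolding Rt_def using finite_edge_colourings by (intro Min_in) auto
  then show thesis using that by blast
qed

lemma packing_count:
  assumes P: "mono_packing H n \<chi> l P" and X: "finite X"
    and m: "\<And>C. C \<in> P \<Longrightarrow> m \<le> card (pverts C \<inter> X)"
  shows "card P * m \<le> card X"
proof -
  have fin: "finite P" using P finite_copies finite_subset by (auto simp: mono_packing_def)
  have "card P * m = (\<Sum>C\<in>P. m)" by simp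
  also have "\<dots> \<le> (\<Sum>C\<in>P. card (pverts C \<inter> X))" by (rule sum_mono) (rule m)
  also have "\<dots> = card (\<Union>C\<in>P. pverts C \<inter> X)"
  proof (rule card_UN_disjoint[symmetric])
    have "pairwise (\<lambda>C D. disjnt (pverts C) (pverts D)) P" using P by (simp add: mono_packing_def)
    then show "\<forall>C\<in>P. \<forall>D\<in>P. C \<noteq> D \<longrightarrow> pverts C \<inter> X \<inter> (pverts D \<inter> X) = {}"
      unfolding pairwise_def disjnt_def by blast
  qed (use fin X in auto)
  also have "\<dots> \<le> card X" using X by (intro card_mono) auto
  finally show ?thesis .
qed

lemma Hall_type_facts:
  assumes "Hall_type H A B"
  shows "pair_graph H" "pverts H = A \<union> B" "A \<inter> B = {}" "finite A" "finite B"
    and "\<And>u v. (u, v) \<in> parcs H \<Longrightarrow> u \<in> A \<and> v \<in> B \<or> u \<in> B \<and> v \<in> A"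
proof -
  from assms show "pair_graph H" "pverts H = A \<union> B" "A \<inter> B = {}"
    and "\<And>u v. (u, v) \<in> parcs H \<Longrightarrow> u \<in> A \<and> v \<in> B \<or> u \<in> B \<and> v \<in> A"
    by (auto simp: Hall_type_def bipartition_def)
  then interpret pair_graph H by simp
  show "finite A" "finite B" using pair_finite_verts \<open>pverts H = A \<union> B\<close> by auto
qed

text \<open>
Both sides are nonempty, so \<open>H\<close> has at least two vertices and connectivity leaves none of them
isolated.
\<close>

lemma vertex_in_edge:
  assumes H: "Hall_type H A B" and A: "A \<noteq> {}" and u: "u \<in> pverts H"
  shows "\<exists>e\<in>edges H. u \<in> e"
proof -
  note facts = Hall_type_facts[OF H]
  have "B \<noteq> {}"
    using H A facts(4) by (auto simp: Hall_type_def)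
  then obtain v where v: "v \<in> pverts H" "v \<noteq> u" using A facts(2,3) by blast
  have "(u, v) \<in> rtrancl_on (pverts H) (parcs (mk_symmetric (with_proj H)))"
    using H u v unfolding Hall_type_def connected_def strongly_connected_def reachable_def
    by (simp add: mk_symmetric_def)
  then have "(u, v) \<in> (parcs (mk_symmetric (with_proj H)))\<^sup>*"
    by (rule rtrancl_on_rtranclI)
  then obtain x where "(u, x) \<in> parcs (mk_symmetric (with_proj H))"
    using v(2) by (metis converse_rtranclE)
  then have "(u, x) \<in> parcs H \<or> (x, u) \<in> parcs H" by (auto simp: mk_symmetric_def)
  then show ?thesis unfolding edges_def by blast
qed

section \<open>Upper bounds\<close>

lemma card_packing_inside:
  assumes H: "Hall_type H A B" and A: "A \<noteq> {}" and P: "mono_packing H n \<chi> l P" and S: "finite S"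
    and col: "\<And>e. e \<in> edges (complete_graph n) \<Longrightarrow> \<chi> e = l \<Longrightarrow> e \<subseteq> S"
  shows "card P * (card A + card B) \<le> card S"
proof (rule packing_count[OF P S])
  fix C assume "C \<in> P"
  then have C: "C \<in> copies H n" and colC: "\<forall>e\<in>edges C. \<chi> e = l" using P by (auto simp: mono_packing_def)
  obtain f where f: "inj_on f (pverts H)" "C = image_graph f H" using C by (rule copiesE)
  have "f u \<in> S" if u: "u \<in> pverts H" for u
  proof -
    obtain e where e: "e \<in> edges H" "u \<in> e" using vertex_in_edge[OF H A u] by blast
    then have "f ` e \<in> edges C" by (simp add: f(2) edges_image_graph)
    then have "f ` e \<subseteq> S" using colC col edges_copy_subset[OF C] by blast
    then show ?thesis using e(2) by blast
  qed
  then have "pverts C \<inter> S = f ` pverts H" using f(2) by auto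
  then have "card (pverts C \<inter> S) = card (pverts H)" using f(1) by (simp add: card_image)
  also have "\<dots> = card A + card B" using Hall_type_facts[OF H] by (simp add: card_Un_disjoint)
  finally show "card A + card B \<le> card (pverts C \<inter> S)" by simp
qed

text \<open>
In a copy of \<open>H\<close> each edge of the matching that saturates \<open>A\<close> contains a vertex of \<open>X\<close>. These vertices
are distinct as the edges are disjoint, and distinct vertices of \<open>A\<close> lie on distinct matching edges
as no edge has both ends in \<open>A\<close>.
\<close>

lemma card_packing_cover:
  assumes H: "Hall_type H A B" and P: "mono_packing H n \<chi> l P" and X: "finite X"
    and col: "\<And>e. e \<in> edges (complete_graph n) \<Longrightarrow> \<chi> e = l \<Longrightarrow> e \<inter> X \<noteq> {}"
  shows "card P * card A \<le> card X"
proof (rule packing_count[OF P X])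
  fix C assume "C \<in> P"
  then have C: "C \<in> copies H n" and colC: "\<forall>e\<in>edges C. \<chi> e = l" using P by (auto simp: mono_packing_def)
  obtain f where f: "inj_on f (pverts H)" "C = image_graph f H" using C by (rule copiesE)
  note facts = Hall_type_facts[OF H]
  obtain M where M: "M \<subseteq> edges H" "disjoint M" "A \<subseteq> \<Union>M"
    using H by (auto simp: Hall_type_def matching_def)
  have "\<exists>e x. e \<in> M \<and> u \<in> e \<and> x \<in> e \<and> f x \<in> X" if u: "u \<in> A" for u
  proof -
    obtain e where e: "e \<in> M" "u \<in> e" using M(3) u by blast
    then have "f ` e \<in> edges C" using M(1) by (auto simp: f(2) edges_image_graph)
    then have "f ` e \<inter> X \<noteq> {}" using colC col edges_copy_subset[OF C] by blast
    then show ?thesis using e by blast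
  qed
  then obtain m h where mh: "\<And>u. u \<in> A \<Longrightarrow> m u \<in> M \<and> u \<in> m u \<and> h u \<in> m u \<and> f (h u) \<in> X" by metis
  interpret pair_graph H by (rule facts)
  have sub: "e \<subseteq> pverts H" if "e \<in> edges H" for e
    using that by (auto simp: edges_def dest: in_arcsD1 in_arcsD2)
  have hV: "h u \<in> pverts H" if "u \<in> A" for u using mh[OF that] sub M(1) by blast
  have "inj_on h A"
  proof (rule inj_onI)
    fix u v assume uv: "u \<in> A" "v \<in> A" "h u = h v"
    then have "h u \<in> m u \<inter> m v" using mh[OF uv(1)] mh[OF uv(2)] by simp
    moreover have "m u \<in> M" "m v \<in> M" using mh uv(1,2) by blast+
    ultimately have "m u = m v" using M(2) by (auto simp: disjoint_def)
    moreover have "m u \<in> edges H" using mh[OF uv(1)] M(1) by blast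
    moreover have "u \<in> m u" "v \<in> m v" using mh uv(1,2) by blast+
    ultimately obtain p q where pq: "(p, q) \<in> parcs H" "u \<in> {p, q}" "v \<in> {p, q}"
      by (auto simp: edges_def)
    from facts(6)[OF pq(1)] show "u = v" using pq(2,3) uv(1,2) facts(3) by blast
  qed
  moreover have "h ` A \<subseteq> pverts H" using hV by blast
  ultimately have "inj_on (f \<circ> h) A" using inj_on_subset[OF f(1)] by (intro comp_inj_on)
  moreover have "(f \<circ> h) ` A \<subseteq> pverts C \<inter> X" using mh hV f(2) by auto
  moreover have "finite (pverts C \<inter> X)" using X by simp
  ultimately show "card A \<le> card (pverts C \<inter> X)" by (rule card_inj_on_le)
qed

lemma Rt3_le_cover_colouring:
  assumes H: "Hall_type H A B" and A: "A \<noteq> {}" and n: "n \<le> (3 * card A + card B) * k"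
  shows "Rt 3 H n \<le> k"
proof -
  define a b where "a = card A" and "b = card B"
  have a: "0 < a" using A Hall_type_facts[OF H] by (auto simp: a_def card_gt_0_iff)
  define X Y where "X = {..<a * k}" and "Y = {a * k..<2 * (a * k)}"
  define F where "F e = (if e \<inter> X \<noteq> {} then 1 else if e \<inter> Y \<noteq> {} then 2 else 3 :: nat)" for e
  have fin: "finite X" "finite Y" by (simp_all add: X_def Y_def)
  have F1: "e \<inter> X \<noteq> {}" if "F e = 1" for e using that by (simp add: F_def split: if_splits)
  have F2: "e \<inter> Y \<noteq> {}" if "F e = 2" for e using that by (simp add: F_def split: if_splits)
  have F3: "e \<subseteq> {2 * (a * k)..<n}" if "e \<in> edges (complete_graph n)" "F e = 3" for e
  proof
    fix x assume "x \<in> e"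
    moreover have "e \<subseteq> {..<n}" using that(1) by (auto simp: edges_complete_graph)
    moreover have "e \<inter> X = {}" "e \<inter> Y = {}" using that(2) by (simp_all add: F_def split: if_splits)
    ultimately have "x < n" "x \<notin> X" "x \<notin> Y" by auto
    then show "x \<in> {2 * (a * k)..<n}" unfolding X_def Y_def by simp
  qed
  show ?thesis
  proof (rule Rt_le[of F])
    fix l P assume l: "l \<in> {1..3}" and P: "mono_packing H n F l P"
    have "l \<in> {1, 2, 3}" using l by auto
    then consider "l = 1" | "l = 2" | "l = 3" by blast
    then show "card P \<le> k"
    proof cases
      case 1
      then have "card P * card A \<le> card X"
        using F1 by (intro card_packing_cover[OF H P fin(1)]) simp
      then show ?thesis using a by (simp add: X_def a_def[symmetric] mult.commute)
    next
      case 2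
      then have "card P * card A \<le> card Y"
        using F2 by (intro card_packing_cover[OF H P fin(2)]) simp
      then show ?thesis using a by (simp add: Y_def a_def[symmetric] mult.commute)
    next
      case 3
      have "card P * (card A + card B) \<le> card {2 * (a * k)..<n}"
        using F3 3 by (intro card_packing_inside[OF H A P]) simp_all
      also have "\<dots> \<le> (a + b) * k" using n by (simp add: a_def b_def algebra_simps)
      finally show ?thesis using a by (simp add: a_def[symmetric] b_def[symmetric] mult.commute)
    qed
  qed (auto simp: F_def)
qed

lemma Rt3_le_parts_colouring:
  assumes H: "Hall_type H A B" and A: "A \<noteq> {}" and n: "n \<le> 3 * k"
  shows "Rt 3 H n * (card A + card B) \<le> 2 * k"
proof -
  define V0 V1 V2 where "V0 = {..<k}" and "V1 = {k..<2 * k}" and "V2 = {2 * k..<3 * k}"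
  \<comment> \<open>an edge inside one part, or from that part to the cyclically next one, gets the colour of that part\<close>
  define F where "F e = (if e \<subseteq> V0 \<union> V1 \<and> e \<inter> V0 \<noteq> {} then 1
      else if e \<subseteq> V1 \<union> V2 \<and> e \<inter> V1 \<noteq> {} then 2 else 3 :: nat)" for e
  have pos: "0 < card A + card B" using A Hall_type_facts[OF H] by (auto simp: card_gt_0_iff)
  have inside: "e \<subseteq> (if l = 1 then V0 \<union> V1 else if l = 2 then V1 \<union> V2 else V2 \<union> V0)"
    if e: "e \<in> edges (complete_graph n)" "F e = l" for e l
  proof -
    obtain u v where uv: "e = {u, v}" "u < n" "v < n" using e(1) by (auto simp: edges_complete_graph)
    have "{u, v} \<subseteq> V0 \<union> V1 \<union> V2" using uv n by (auto simp: V0_def V1_def V2_def)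
    moreover have "V0 \<inter> V1 = {}" "V0 \<inter> V2 = {}" "V1 \<inter> V2 = {}" by (auto simp: V0_def V1_def V2_def)
    ultimately show ?thesis using e(2) unfolding F_def uv(1) by (auto split: if_splits)
  qed
  have card2: "card (U \<union> W) \<le> 2 * k" if "card U \<le> k" "card W \<le> k" for U W :: "nat set"
    using that card_Un_le[of U W] by linarith
  have "Rt 3 H n \<le> 2 * k div (card A + card B)"
  proof (rule Rt_le[of F])
    fix l P assume l: "l \<in> {1..3}" and P: "mono_packing H n F l P"
    let ?S = "if l = 1 then V0 \<union> V1 else if l = 2 then V1 \<union> V2 else V2 \<union> V0"
    have "card P * (card A + card B) \<le> card ?S"
      using inside by (intro card_packing_inside[OF H A P]) (auto simp: V0_def V1_def V2_def)
    also have "\<dots> \<le> 2 * k"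
      using card2[of V0 V1] card2[of V1 V2] card2[of V2 V0] by (simp add: V0_def V1_def V2_def)
    finally show "card P \<le> 2 * k div (card A + card B)" using pos by (simp add: less_eq_div_iff_mult_less_eq)
  qed (auto simp: F_def)
  then show ?thesis using pos by (simp add: less_eq_div_iff_mult_less_eq)
qed

section \<open>Lower bound\<close>

lemma disjoint_blocks_in:
  assumes "finite I" "card I * s \<le> card X"
  shows "\<exists>T. (\<forall>i\<in>I. T i \<subseteq> X \<and> card (T i) = s) \<and> disjoint_family_on T I"
  using assms
proof (induction I arbitrary: X rule: finite_induct)
  case empty
  then show ?case by (auto simp: disjoint_family_on_def)
next
  case (insert i I)
  then have le: "s + card I * s \<le> card X" by simp
  then obtain S where S: "S \<subseteq> X" "card S = s" "finite S"
    using obtain_subset_with_card_n[of s X] by auto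
  have "card I * s \<le> card (X - S)" using le S by (simp add: card_Diff_subset)
  then obtain T where T: "\<forall>i\<in>I. T i \<subseteq> X - S \<and> card (T i) = s" "disjoint_family_on T I"
    using insert.IH by blast
  have "(\<forall>j\<in>insert i I. (T(i := S)) j \<subseteq> X \<and> card ((T(i := S)) j) = s)"
    using T(1) S by auto
  moreover have "disjoint_family_on (T(i := S)) (insert i I)"
    unfolding disjoint_family_on_def
  proof (intro ballI impI)
    fix m n assume mn: "m \<in> insert i I" "n \<in> insert i I" "m \<noteq> n"
    have "T j \<inter> S = {}" if "j \<in> I" for j using T(1) that by blast
    then show "(T(i := S)) m \<inter> (T(i := S)) n = {}"
      using mn disjoint_family_onD[OF T(2), of m n] by (cases "m = i"; cases "n = i") auto
  qed
  ultimately show ?case by (intro exI[of _ "T(i := S)"] conjI)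
qed

text \<open>
In the weighted case, rescale by \<open>a + b\<close> and cut at the threshold \<open>\<theta>\<close>. A biclique between the light
vertices and the vertices that are not heavy would contain a tile with its \<open>B\<close>-blocks on the light
side, of weight less than \<open>b s \<theta> + a s (1 + (b/a) (1 - \<theta>)) = (a + b) s\<close>, which is less than any tile
weighs.
\<close>

lemma packing_or_sparse_pair:
  fixes H :: "'v pair_pre_digraph" and A B :: "'v set" and n k M J :: nat and \<chi> :: "nat set \<Rightarrow> nat"
  defines "a \<equiv> card A" and "b \<equiv> card B"
  defines "s \<equiv> k\<^sup>2 * (k\<^sup>2 + 1)\<^sup>2"
  assumes H: "Hall_type H A B" and A: "A \<noteq> {}"
    and k: "1 \<le> k" and J: "1 \<le> J" and few: "M * (a + b) * k\<^sup>2 \<le> n"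
    and small: "\<And>P. mono_packing H n \<chi> l P \<Longrightarrow> 2 * k * card P + 3 * n < 2 * k * (M * k\<^sup>2)"
  obtains I N :: "nat set" where "I \<subseteq> {..<n}" "N \<subseteq> {..<n}" "I \<inter> N = {}"
    and "real n - card I + real b / a * card N \<le> real (a + b) * real (M * k\<^sup>2) + real b / a * n / J"
    and "biclique_free (\<lambda>u v. \<chi> {u, v}) l ((a + b) * s) I ({..<n} - N)"
proof -
  note facts = Hall_type_facts[OF H]
  have a: "0 < a" using A facts(4) by (simp add: a_def card_gt_0_iff)
  have ab: "a \<le> b" using H by (simp add: Hall_type_def a_def b_def)
  have s: "0 < s" using k by (simp add: s_def)
  have cH: "card (pverts H) = a + b" using facts by (simp add: card_Un_disjoint a_def b_def)
  have fH: "finite (pverts H)" using facts by simp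
  interpret pair_graph H by (rule facts)
  define tiles where "tiles = {T \<in> block_families {..<n} (pverts H) s.
    \<forall>(u, v)\<in>parcs H. \<forall>x\<in>T u. \<forall>y\<in>T v. \<chi> {x, y} = l}"
  have tiles: "tiles \<subseteq> block_families {..<n} (pverts H) (k\<^sup>2 * (k\<^sup>2 + 1)\<^sup>2)"
    by (auto simp: tiles_def s_def)
  have few': "M * card (pverts H) * k\<^sup>2 \<le> card {..<n}" using few cH by simp
  show thesis
  proof (rule transversals_or_weights[OF finite_lessThan fH tiles few'])
    fix C :: "(nat \<times> nat) set" and g :: "nat \<times> nat \<Rightarrow> 'v \<Rightarrow> nat"
    assume transversals: "finite C" "2 * k * (M * k\<^sup>2) \<le> 2 * k * card C + 3 * card {..<n}"
      "\<And>c. c \<in> C \<Longrightarrow> \<exists>T\<in>tiles. \<forall>i\<in>pverts H. g c i \<in> T i"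
      "inj_on (\<lambda>(c, i). g c i) (C \<times> pverts H)"
    define P where "P = (\<lambda>c. image_graph (g c) H) ` C"
    have gT: "\<exists>T\<in>tiles. \<forall>i\<in>pverts H. g c i \<in> T i" if "c \<in> C" for c using transversals(3) that .
    have ginj: "c = c' \<and> i = i'" if "c \<in> C" "c' \<in> C" "i \<in> pverts H" "i' \<in> pverts H" "g c i = g c' i'" for c c' i i'
      using inj_onD[OF transversals(4), of "(c, i)" "(c', i')"] that by auto
    have copy: "image_graph (g c) H \<in> copies H n" if c: "c \<in> C" for c
    proof (rule image_graph_in_copies[OF facts(1)])
      show "inj_on (g c) (pverts H)" using ginj[OF c c] by (auto intro: inj_onI)
      show "g c ` pverts H \<subseteq> {..<n}" using gT[OF c] by (fastforce simp: tiles_def block_families_def)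
    qed
    have disj: "c = c'" if c: "c \<in> C" "c' \<in> C" and meet: "\<not> disjnt (g c ` pverts H) (g c' ` pverts H)" for c c'
    proof -
      obtain i i' where "i \<in> pverts H" "i' \<in> pverts H" "g c i = g c' i'"
        using meet by (auto simp: disjnt_iff)
      then show ?thesis using ginj[OF c] by blast
    qed
    have "mono_packing H n \<chi> l P"
      unfolding mono_packing_def
    proof (intro conjI ballI)
      show "P \<subseteq> copies H n" using copy by (auto simp: P_def)
      show "pairwise (\<lambda>C D. disjnt (pverts C) (pverts D)) P"
        unfolding P_def pairwise_def using disj by auto
      fix Q e assume "Q \<in> P" "e \<in> edges Q"
      then obtain c where c: "c \<in> C" "e \<in> edges (image_graph (g c) H)" by (auto simp: P_def)
      then obtain u v where uv: "(u, v) \<in> parcs H" "e = {g c u, g c v}"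
        by (auto simp: edges_def)
      obtain T where "T \<in> tiles" "\<forall>i\<in>pverts H. g c i \<in> T i" using gT[OF c(1)] by blast
      then show "\<chi> e = l" using uv in_arcsD1[OF uv(1)] in_arcsD2[OF uv(1)] by (auto simp: tiles_def)
    qed
    moreover have "inj_on (\<lambda>c. image_graph (g c) H) C"
    proof (rule inj_onI)
      fix c c' assume c: "c \<in> C" "c' \<in> C" "image_graph (g c) H = image_graph (g c') H"
      then have "g c ` pverts H = g c' ` pverts H" by (metis image_graph_simps(1))
      moreover have "pverts H \<noteq> {}" using A facts(2) by blast
      ultimately show "c = c'" using disj[OF c(1,2)] by (auto simp: disjnt_def)
    qed
    then have "card P = card C" by (simp add: P_def card_image)
    ultimately show thesis using small[of P] transversals(2) by simp
  next
    fix w :: "nat \<Rightarrow> real"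
    assume weights: "\<And>v. 0 \<le> w v" "(\<Sum>v\<in>{..<n}. w v) \<le> real (M * k\<^sup>2)"
      "\<And>T. T \<in> tiles \<Longrightarrow> real (k\<^sup>2 * (k\<^sup>2 + 1)\<^sup>2) \<le> (\<Sum>i\<in>pverts H. \<Sum>v\<in>T i. w v)"
    define \<beta> where "\<beta> = real b / a"
    have \<beta>: "0 < \<beta>" "a * \<beta> = b" using a ab by (auto simp: \<beta>_def)
    define z where "z v = (a + b) * w v" for v
    have z0: "0 \<le> z v" for v using weights(1) by (simp add: z_def)
    obtain \<theta> where \<theta>: "0 < \<theta>" "\<theta> \<le> 1"
      and cost: "real (card {..<n}) - card {v\<in>{..<n}. z v < \<theta>}
          + \<beta> * card {v\<in>{..<n}. 1 + \<beta> * (1 - \<theta>) \<le> z v} \<le> (\<Sum>v\<in>{..<n}. z v) + \<beta> * card {..<n} / J"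
      by (rule threshold_rounding[where z = z, OF finite_lessThan[of n] z0 \<beta>(1) J])
    define I where "I = {v\<in>{..<n}. z v < \<theta>}"
    define N where "N = {v\<in>{..<n}. 1 + \<beta> * (1 - \<theta>) \<le> z v}"
    have "0 \<le> \<beta> * (1 - \<theta>)" using \<beta> \<theta> by simp
    then have disj: "I \<inter> N = {}" using \<theta> by (auto simp: I_def N_def)
    have "(\<Sum>v\<in>{..<n}. z v) \<le> real (a + b) * real (M * k\<^sup>2)"
      using weights(2) unfolding z_def sum_distrib_left[symmetric] by (intro mult_left_mono) auto
    then have cost': "real n - card I + \<beta> * card N \<le> real (a + b) * real (M * k\<^sup>2) + \<beta> * n / J"
      using cost by (simp add: I_def N_def)
    have sparse: "\<exists>x\<in>X. \<exists>y\<in>Y. \<chi> {x, y} \<noteq> l"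
      if X: "X \<subseteq> I" and Y: "Y \<subseteq> {..<n} - N" and XY: "X \<inter> Y = {}"
        and cX: "card X = (a + b) * s" and cY: "card Y = (a + b) * s" for X Y
    proof (rule ccontr)
      assume "\<not> ?thesis"
      then have mono: "\<chi> {x, y} = l" "\<chi> {y, x} = l" if "x \<in> X" "y \<in> Y" for x y
        using that by (auto simp: insert_commute)
      obtain TA where TA: "\<forall>i\<in>A. TA i \<subseteq> Y \<and> card (TA i) = s" "disjoint_family_on TA A"
        using disjoint_blocks_in[OF facts(4), of s Y] cY by (auto simp: a_def)
      obtain TB where TB: "\<forall>i\<in>B. TB i \<subseteq> X \<and> card (TB i) = s" "disjoint_family_on TB B"
        using disjoint_blocks_in[OF facts(5), of s X] cX by (auto simp: b_def)
      define T where "T i = (if i \<in> A then TA i else TB i)" for i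
      have TonA: "T i \<subseteq> Y" "card (T i) = s" if "i \<in> A" for i using TA that by (auto simp: T_def)
      have TonB: "T i \<subseteq> X" "card (T i) = s" if "i \<in> B" for i using TB that facts(3) by (auto simp: T_def)
      have "T i \<inter> T j = {}" if ij: "i \<in> A \<union> B" "j \<in> A \<union> B" "i \<noteq> j" for i j
      proof -
        consider "i \<in> A" "j \<in> A" | "i \<in> B" "j \<in> B" | "i \<in> A" "j \<in> B" | "i \<in> B" "j \<in> A" using ij by blast
        then show ?thesis
        proof cases
          case 1 then show ?thesis using disjoint_family_onD[OF TA(2)] ij(3) by (simp add: T_def)
        next
          case 2
          then have "i \<notin> A" "j \<notin> A" using facts(3) by auto
          then show ?thesis using 2 disjoint_family_onD[OF TB(2)] ij(3) by (simp add: T_def)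
        qed (use TonA TonB XY in blast)+
      qed
      then have dT: "disjoint_family_on T (pverts H)" unfolding facts(2) by (simp add: disjoint_family_on_def)
      have XV: "X \<subseteq> {..<n}" "Y \<subseteq> {..<n}" using X Y by (auto simp: I_def)
      have "T \<in> block_families {..<n} (pverts H) s"
        using dT TonA TonB XV unfolding block_families_def facts(2) by blast
      moreover have "\<chi> {x, y} = l" if "(u, v) \<in> parcs H" "x \<in> T u" "y \<in> T v" for u v x y
        using facts(6)[OF that(1)] that(2,3) TonA(1) TonB(1) mono by blast
      ultimately have "T \<in> tiles" by (auto simp: tiles_def)
      then have "real s \<le> (\<Sum>i\<in>pverts H. \<Sum>v\<in>T i. w v)"
        using weights(3) by (simp add: s_def)
      then have "real (a + b) * real s \<le> (a + b) * (\<Sum>i\<in>pverts H. \<Sum>v\<in>T i. w v)"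
        by (rule mult_left_mono) simp
      also have "\<dots> = (\<Sum>i\<in>pverts H. \<Sum>v\<in>T i. z v)" by (simp add: z_def sum_distrib_left)
      also have "\<dots> = (\<Sum>i\<in>A. \<Sum>v\<in>T i. z v) + (\<Sum>i\<in>B. \<Sum>v\<in>T i. z v)"
        unfolding facts(2) using facts by (intro sum.union_disjoint) auto
      also have "(\<Sum>i\<in>A. \<Sum>v\<in>T i. z v) < (\<Sum>i\<in>A. s * (1 + \<beta> * (1 - \<theta>)))"
      proof (rule sum_strict_mono)
        fix i assume i: "i \<in> A"
        have fin: "finite (T i)" "T i \<noteq> {}" using TonA(2)[OF i] s by (auto intro: card_ge_0_finite)
        have "(\<Sum>v\<in>T i. z v) < (\<Sum>v\<in>T i. 1 + \<beta> * (1 - \<theta>))"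
        proof (rule sum_strict_mono[OF fin])
          fix v assume "v \<in> T i"
          then have "v < n" "v \<notin> N" using TonA(1)[OF i] Y by auto
          then show "z v < 1 + \<beta> * (1 - \<theta>)" by (simp add: N_def)
        qed
        then show "(\<Sum>v\<in>T i. z v) < s * (1 + \<beta> * (1 - \<theta>))" using TonA(2)[OF i] by simp
      qed (use facts A in auto)
      also have "(\<Sum>i\<in>B. \<Sum>v\<in>T i. z v) \<le> (\<Sum>i\<in>B. s * \<theta>)"
      proof (rule sum_mono)
        fix i assume i: "i \<in> B"
        have "(\<Sum>v\<in>T i. z v) \<le> (\<Sum>v\<in>T i. \<theta>)"
          using TonB(1)[OF i] X by (intro sum_mono) (auto simp: I_def)
        then show "(\<Sum>v\<in>T i. z v) \<le> s * \<theta>" using TonB(2)[OF i] by simp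
      qed
      also have "(\<Sum>i\<in>A. s * (1 + \<beta> * (1 - \<theta>))) + (\<Sum>i\<in>B. s * \<theta>) = s * (a + a * \<beta> * (1 - \<theta>) + b * \<theta>)"
        by (simp add: a_def b_def algebra_simps)
      also have "\<dots> = real (a + b) * real s" unfolding \<beta>(2) by (simp add: algebra_simps)
      finally show False by simp
    qed
    have sub: "I \<subseteq> {..<n}" "N \<subseteq> {..<n}" by (auto simp: I_def N_def)
    have "biclique_free (\<lambda>u v. \<chi> {u, v}) l ((a + b) * s) I ({..<n} - N)"
      unfolding biclique_free_def using sparse by blast
    then show thesis by (rule that[OF sub disj cost'[unfolded \<beta>_def]])
  qed
qed

text \<open>
If every colour of an optimal colouring had too few copies, all three would produce sparse pairs.
The slack \<open>\<eta> = \<epsilon> / 4\<close> in the number of tiles absorbs the rounding of \<open>M\<close>, the deficits (through \<open>k\<close>)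
and the threshold error (through \<open>J\<close>), and still leaves the linear surplus \<open>\<delta>\<close> that beats the Ramsey
constant. The two bounds on \<open>c\<close> are the conditions on \<open>t = 1 - (a + b) c\<close> in
\<open>three_colours_leave_no_sparse_pairs\<close>.
\<close>

lemma Rt3_lower_bound:
  fixes H :: "'v pair_pre_digraph" and A B :: "'v set" and c \<epsilon> :: real
  defines "a \<equiv> card A" and "b \<equiv> card B"
  assumes H: "Hall_type H A B" and A: "A \<noteq> {}"
    and c: "c * (3 * a + b) \<le> 1" "3 * c * (a + b) \<le> 2" and \<epsilon>: "0 < \<epsilon>"
  shows "\<forall>\<^sub>F n in sequentially. (c - \<epsilon>) * n \<le> Rt 3 H n"
proof (cases "c \<le> \<epsilon>")
  case True
  then have "(c - \<epsilon>) * real n \<le> 0" for n by (intro mult_nonpos_nonneg) auto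
  then show ?thesis by (intro always_eventually allI) (meson of_nat_0_le_iff order_trans)
next
  case False
  note facts = Hall_type_facts[OF H]
  have a: "0 < a" using A facts(4) by (simp add: a_def card_gt_0_iff)
  have ab: "a \<le> b" using H by (simp add: Hall_type_def a_def b_def)
  define d where "d = real (a + b)"
  have d: "0 < d" using a by (simp add: d_def)
  have c1: "2 * (c * a) + c * d \<le> 1" and c2: "3 * (c * d) \<le> 2"
    using c by (simp_all add: d_def algebra_simps)
  define \<eta> where "\<eta> = \<epsilon> / 4"
  define \<beta> where "\<beta> = real b / a"
  have \<eta>: "0 < \<eta>" "\<eta> < c" using \<epsilon> False by (auto simp: \<eta>_def)
  have \<beta>: "1 \<le> \<beta>" using a ab by (simp add: \<beta>_def)
  define k where "k = nat \<lceil>6 / \<epsilon>\<rceil>"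
  have k6: "6 / \<epsilon> \<le> k" unfolding k_def by linarith
  have "0 < 6 / \<epsilon>" using \<epsilon> by simp
  then have "0 < real k" using k6 by linarith
  then have k: "1 \<le> k" by simp
  define K where "K = k\<^sup>2"
  have K: "0 < K" using k by (simp add: K_def)
  define J where "J = nat \<lceil>2 * \<beta> / (d * \<eta>)\<rceil>"
  have J2: "2 * \<beta> / (d * \<eta>) \<le> J" unfolding J_def by linarith
  have "0 < 2 * \<beta> / (d * \<eta>)" using \<beta> \<eta> d by simp
  then have "0 < real J" using J2 by linarith
  then have J: "1 \<le> J" by simp
  define p where "p = (a + b) * (k\<^sup>2 * (k\<^sup>2 + 1)\<^sup>2)"
  define R where "R = biclique_bound 3 p"
  have "\<forall>\<^sub>F n in sequentially. real K / \<eta> \<le> real n"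
    using eventually_ge_at_top[of "nat \<lceil>real K / \<eta>\<rceil>"] by eventually_elim linarith
  moreover have "\<forall>\<^sub>F n in sequentially. 3 * real R / (d * \<eta> / 2) < real n"
    using eventually_gt_at_top[of "nat \<lceil>3 * real R / (d * \<eta> / 2)\<rceil>"] by eventually_elim linarith
  ultimately show ?thesis
  proof eventually_elim
    case (elim n)
    have Kn: "real K \<le> \<eta> * n" using elim(1) \<eta> by (simp add: pos_divide_le_eq mult.commute)
    have Rn: "3 * real R < d * \<eta> / 2 * n"
      using elim(2) \<eta> d by (simp add: pos_divide_less_eq mult.commute)
    obtain \<chi> where \<chi>: "\<chi> \<in> edge_colourings 3 n" "Rt 3 H n = packing_number 3 H n \<chi>"
      using Rt_attained[of 3 n H] by auto
    have col: "\<chi> {u, v} \<in> {1..3}" if "u < n" "v < n" "u \<noteq> v" for u v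
    proof -
      have "{u, v} \<in> edges (complete_graph n)" using that by (auto simp: edges_complete_graph)
      then show ?thesis by (rule PiE_mem[OF \<chi>(1)[unfolded edge_colourings_def]])
    qed
    show ?case
    proof (rule ccontr)
      assume "\<not> ?case"
      then have less: "real (packing_number 3 H n \<chi>) < (c - \<epsilon>) * n" using \<chi>(2) by simp
      define M where "M = nat \<lfloor>(c - \<eta>) * n / K\<rfloor>"
      have "0 \<le> (c - \<eta>) * n / K" using \<eta> by simp
      then have "real M \<le> (c - \<eta>) * n / K" "(c - \<eta>) * n / K \<le> real M + 1" unfolding M_def by linarith+
      then have M: "M * real K \<le> (c - \<eta>) * n" "(c - \<eta>) * n \<le> M * real K + K"
        using K by (simp_all add: field_simps)
      have few: "M * (a + b) * K \<le> n"
      proof -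
        have "d * (M * real K) \<le> d * ((c - \<eta>) * n)" using M(1) d by (intro mult_left_mono) auto
        also have "\<dots> \<le> d * (c * n)" using \<eta> d by (intro mult_left_mono mult_right_mono) auto
        also have "\<dots> = (c * d) * n" by simp
        also have "\<dots> \<le> 1 * real n" using c2 by (intro mult_right_mono) auto
        finally have "real (M * (a + b) * K) \<le> real n" by (simp add: d_def algebra_simps)
        then show ?thesis by (simp only: of_nat_le_iff)
      qed
      have small: "2 * k * card P + 3 * n < 2 * k * (M * k\<^sup>2)"
        if P: "l \<in> {1..3}" "mono_packing H n \<chi> l P" for l P
      proof -
        have "real (card P) < (c - \<epsilon>) * n"
          using card_le_packing_number[OF P(2,1)] less by linarith
        also have "(c - \<epsilon>) * n = (c - \<eta>) * n - 3 * \<eta> * n" by (simp add: \<eta>_def algebra_simps)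
        also have "\<dots> \<le> M * real K + K - 3 * \<eta> * n" using M(2) by simp
        also have "\<dots> \<le> M * real K - 2 * (\<eta> * n)" using Kn by simp
        finally have "2 * k * real (card P) < 2 * k * (M * real K - 2 * (\<eta> * n))"
          using k by (intro mult_strict_left_mono) auto
        also have "\<dots> = 2 * k * (M * real K) - (4 * \<eta> * k) * n" by (simp add: algebra_simps)
        also have "\<dots> \<le> 2 * k * (M * real K) - 3 * n"
        proof -
          have "6 \<le> k * \<epsilon>" using k6 \<epsilon> by (simp add: pos_divide_le_eq)
          then have "3 \<le> 4 * \<eta> * k" by (simp add: \<eta>_def mult.commute)
          then have "3 * real n \<le> (4 * \<eta> * k) * n" by (intro mult_right_mono) auto
          then show ?thesis by simp
        qed
        finally have "real (2 * k * card P + 3 * n) < real (2 * k * (M * k\<^sup>2))" by (simp add: K_def)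
        then show ?thesis by (simp only: of_nat_less_iff)
      qed
      have "\<exists>I N. I \<subseteq> {..<n} \<and> N \<subseteq> {..<n} \<and> I \<inter> N = {} \<and> (l \<in> {1..3} \<longrightarrow>
          real n - card I + \<beta> * card N \<le> d * real (M * k\<^sup>2) + \<beta> * n / J \<and>
          biclique_free (\<lambda>u v. \<chi> {u, v}) l p I ({..<n} - N))" for l
      proof (cases "l \<in> {1..3}")
        case True
        obtain I N where IN: "I \<subseteq> {..<n}" "N \<subseteq> {..<n}" "I \<inter> N = {}"
            "real n - card I + \<beta> * card N \<le> d * real (M * k\<^sup>2) + \<beta> * n / J"
          and none: "biclique_free (\<lambda>u v. \<chi> {u, v}) l p I ({..<n} - N)"
          by (rule packing_or_sparse_pair[OF H A k J few[unfolded K_def a_def b_def] small[OF True],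
                folded a_def b_def, folded p_def \<beta>_def d_def])
        show ?thesis using IN none by (intro exI[of _ I] exI[of _ N]) simp
      next
        case False then show ?thesis by (intro exI[of _ "{}"]) auto
      qed
      then obtain I N where I: "\<And>l. I l \<subseteq> {..<n}" and N: "\<And>l. N l \<subseteq> {..<n}" and disj: "\<And>l. I l \<inter> N l = {}"
        and cost: "\<And>l. l \<in> {1..3} \<Longrightarrow>
          real n - card (I l) + \<beta> * card (N l) \<le> d * real (M * k\<^sup>2) + \<beta> * n / J"
        and free: "\<And>l. l \<in> {1..3} \<Longrightarrow> biclique_free (\<lambda>u v. \<chi> {u, v}) l p (I l) ({..<n} - N l)"
        by metis
      define t where "t = 1 - d * c"
      define \<delta> where "\<delta> = d * \<eta> / 2 * n"
      show False
      proof (rule three_colours_leave_no_sparse_pairs[of "{..<n}" "\<lambda>u v. \<chi> {u, v}" I N R p \<beta> t \<delta>])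
        show "\<exists>X\<subseteq>U. \<exists>Y\<subseteq>W. \<exists>l\<in>{1..3}. card X = p \<and> card Y = p \<and> (\<forall>x\<in>X. \<forall>y\<in>Y. \<chi> {x, y} = l)"
          if "U \<subseteq> {..<n}" "W \<subseteq> {..<n}" "U \<inter> W = {}" "R \<le> card U" "R \<le> card W" for U W
        proof (rule bipartite_ramsey)
          show "\<chi> {u, w} \<in> {1..3}" if "u \<in> U" "w \<in> W" for u w
            using \<open>U \<subseteq> {..<n}\<close> \<open>W \<subseteq> {..<n}\<close> \<open>U \<inter> W = {}\<close> that by (intro col) auto
        qed (use that in \<open>simp_all add: R_def\<close>)
        show "\<beta> * card (N l) + t * card {..<n} + \<delta> \<le> card (I l)" if l: "l \<in> {1..3}" for l
        proof -
          have le1: "d * real (M * k\<^sup>2) \<le> d * ((c - \<eta>) * n)"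
            using M(1) d by (intro mult_left_mono) (auto simp: K_def)
          have "2 * \<beta> \<le> J * (d * \<eta>)" using J2 d \<eta> by (simp add: pos_divide_le_eq)
          then have "\<beta> / J \<le> d * \<eta> / 2" using J by (simp add: pos_divide_le_eq mult.commute)
          then have "\<beta> / J * n \<le> d * \<eta> / 2 * n" by (rule mult_right_mono) simp
          then have le2: "\<beta> * n / J \<le> d * \<eta> / 2 * n" by simp
          have "d * ((c - \<eta>) * n) + d * \<eta> / 2 * n = d * c * n - d * \<eta> / 2 * n"
            by (simp add: field_simps)
          moreover have "t * n = n - d * c * n" by (simp add: t_def algebra_simps)
          ultimately show ?thesis
            using cost[OF l] le1 le2 unfolding \<delta>_def card_lessThan by linarith
        qed
        show "1 \<le> 3 * t" using c2 by (simp add: t_def algebra_simps)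
        show "2 * (1 - t) \<le> t * (1 + \<beta>)"
        proof -
          have "real a * (2 * (1 - t)) = d * (2 * a * c)" by (simp add: t_def algebra_simps)
          also have "\<dots> \<le> d * t"
            using c1 d by (intro mult_left_mono) (auto simp: t_def algebra_simps)
          also have "\<dots> = a * (t * (1 + \<beta>))" using a by (simp add: \<beta>_def d_def field_simps)
          finally show ?thesis using a by simp
        qed
        show "3 * real R < \<delta>" using Rn by (simp add: \<delta>_def)
        show "\<chi> {u, v} = \<chi> {v, u}" for u v by (simp add: insert_commute)
      qed (simp_all add: I N disj free \<beta>)
    qed
  qed
qed

lemma smallo_error_of_linear_bounds:
  fixes f :: "nat \<Rightarrow> nat" and c C :: real
  assumes zero: "f 0 = 0"
    and lower: "\<And>\<epsilon>. 0 < \<epsilon> \<Longrightarrow> \<forall>\<^sub>F n in sequentially. (c - \<epsilon>) * n \<le> f n"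
    and upper: "\<And>n. f n \<le> c * n + C"
  shows "\<exists>\<epsilon> :: nat \<Rightarrow> real. \<epsilon> \<in> o(\<lambda>_. 1) \<and> (\<forall>n. real (f n) = (c + \<epsilon> n) * n)"
proof -
  define e where "e n = (if n = 0 then 0 else f n / n - c)" for n
  have "e \<longlonglongrightarrow> 0"
  proof (rule LIMSEQ_I)
    fix \<epsilon> :: real assume \<epsilon>: "0 < \<epsilon>"
    have "\<forall>\<^sub>F n in sequentially. C / \<epsilon> < real n"
      using eventually_gt_at_top[of "nat \<lceil>C / \<epsilon>\<rceil>"] by eventually_elim linarith
    moreover have "\<forall>\<^sub>F n in sequentially. (c - \<epsilon> / 2) * n \<le> f n" using \<epsilon> by (intro lower) simp
    moreover have "\<forall>\<^sub>F n in sequentially. 0 < n" by (rule eventually_gt_at_top)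
    ultimately have "\<forall>\<^sub>F n in sequentially. norm (e n - 0) < \<epsilon>"
    proof eventually_elim
      case (elim n)
      have "C < \<epsilon> * n" using elim(1) \<epsilon> by (simp add: pos_divide_less_eq mult.commute)
      then have "f n < (c + \<epsilon>) * n" using upper[of n] by (simp add: algebra_simps)
      then have "f n / n < c + \<epsilon>" using elim(3) by (simp add: pos_divide_less_eq)
      moreover have "c - \<epsilon> / 2 \<le> f n / n" using elim(2,3) by (simp add: pos_le_divide_eq)
      ultimately show ?case using elim(3) \<epsilon> by (auto simp: e_def abs_less_iff)
    qed
    then show "\<exists>no. \<forall>n\<ge>no. norm (e n - 0) < \<epsilon>" by (simp add: eventually_sequentially)
  qed
  then have "e \<in> o(\<lambda>_. 1)" by (intro smalloI_tendsto) auto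
  moreover have "real (f n) = (c + e n) * n" for n using zero by (simp add: e_def)
  ultimately show ?thesis by blast
qed

section \<open>The asymptotic value\<close>

theorem theorem6p5:
  fixes a b :: nat and H :: "'v pair_pre_digraph" and A B :: "'v set"
  assumes "1 \<le> a" and "a \<le> b"
    and "Hall_type H A B" and "card A = a" and "card B = b"
  shows "(b \<le> 3 * a \<longrightarrow>
           (\<exists>\<epsilon> :: nat \<Rightarrow> real. \<epsilon> \<in> o(\<lambda>_. 1) \<and>
             (\<forall>n. real (Rt 3 H n) = (1 / (3 * real a + real b) + \<epsilon> n) * real n))) \<and>
         (b \<ge> 3 * a \<longrightarrow>
           (\<exists>\<epsilon> :: nat \<Rightarrow> real. \<epsilon> \<in> o(\<lambda>_. 1) \<and>
             (\<forall>n. real (Rt 3 H n) = (2 / (3 * (real a + real b)) + \<epsilon> n) * real n)))"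
proof (intro conjI impI)
  note H = assms(3)
  have A: "A \<noteq> {}" using assms by auto
  have zero: "Rt 3 H 0 = 0" using Rt3_le_cover_colouring[OF H A, of 0 0] by simp
  have a: "0 < real a" using assms(1) by simp
  {
    assume b: "b \<le> 3 * a"
    let ?c = "1 / (3 * real a + real b)"
    show "\<exists>\<epsilon> :: nat \<Rightarrow> real. \<epsilon> \<in> o(\<lambda>_. 1) \<and> (\<forall>n. real (Rt 3 H n) = (?c + \<epsilon> n) * real n)"
    proof (rule smallo_error_of_linear_bounds[where f = "Rt 3 H" and C = 1, OF zero])
      fix \<epsilon> :: real assume "0 < \<epsilon>"
      moreover have "0 < 3 * real a + real b" using a by simp
      then have "?c * (3 * a + b) \<le> 1" "3 * ?c * (a + b) \<le> 2"
        using b by (simp_all add: pos_divide_le_eq)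
      ultimately show "\<forall>\<^sub>F n in sequentially. (?c - \<epsilon>) * n \<le> Rt 3 H n"
        by (intro Rt3_lower_bound[OF H A]) (simp_all add: assms(4,5))
    next
      fix n :: nat
      define k where "k = nat \<lceil>n / (3 * real a + real b)\<rceil>"
      have k: "n / (3 * real a + real b) \<le> k" "k \<le> n / (3 * real a + real b) + 1"
        unfolding k_def using divide_nonneg_nonneg[of "real n" "3 * real a + real b"] by linarith+
      have "real n \<le> real ((3 * a + b) * k)" using k(1) a by (simp add: pos_divide_le_eq mult.commute add_pos_nonneg)
      then have "n \<le> (3 * card A + card B) * k" unfolding assms(4,5) by (simp only: of_nat_le_iff)
      from Rt3_le_cover_colouring[OF H A this] show "Rt 3 H n \<le> ?c * n + 1" using k(2) by simp
    qed
  }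
  {
    assume b: "b \<ge> 3 * a"
    let ?c = "2 / (3 * (real a + real b))"
    show "\<exists>\<epsilon> :: nat \<Rightarrow> real. \<epsilon> \<in> o(\<lambda>_. 1) \<and> (\<forall>n. real (Rt 3 H n) = (?c + \<epsilon> n) * real n)"
    proof (rule smallo_error_of_linear_bounds[where f = "Rt 3 H" and C = 2, OF zero])
      fix \<epsilon> :: real assume "0 < \<epsilon>"
      moreover have "0 < 3 * (real a + real b)" using a by simp
      then have "?c * (3 * a + b) \<le> 1" "3 * ?c * (a + b) \<le> 2"
        using b by (simp_all add: pos_divide_le_eq)
      ultimately show "\<forall>\<^sub>F n in sequentially. (?c - \<epsilon>) * n \<le> Rt 3 H n"
        by (intro Rt3_lower_bound[OF H A]) (simp_all add: assms(4,5))
    next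
      fix n :: nat
      define k where "k = n div 3 + 1"
      have "Rt 3 H n * (a + b) \<le> 2 * k"
        using Rt3_le_parts_colouring[OF H A, of n k] by (simp add: assms(4,5) k_def)
      then have "real (Rt 3 H n * (a + b)) \<le> real (2 * k)" by (simp only: of_nat_le_iff)
      also have "\<dots> \<le> 2 * (n / 3) + 2" unfolding k_def by simp
      finally have "Rt 3 H n \<le> (2 * (n / 3) + 2) / (real a + real b)"
        using a by (simp add: pos_le_divide_eq add_pos_nonneg)
      also have "\<dots> = ?c * n + 2 / (real a + real b)" by (simp add: add_divide_distrib)
      also have "2 / (real a + real b) \<le> 2" using assms(1) by (simp add: pos_divide_le_eq add_pos_nonneg)
      finally show "Rt 3 H n \<le> ?c * n + 2" by simp
    qed
  }
qed

end
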